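(* Let $X$ be a compact Riemannian (triangulable) submanifold of $\mathbb{R}^m$ with condition number $1/\tau$, and let $f:\mathbb{R}^m\to\mathbb{R}^n$ be a continuous function with modulus of continuity $\Omega$. Let $0<s<(\sqrt9-\sqrt8)\,\tau$ and $$\delta\in\left(\frac{(s+\tau)-\sqrt{s^2+\tau^2-6s\tau}}{2},\ \frac{(s+\tau)+\sqrt{s^2+\tau^2-6s\tau}}{2}\right).$$ Let $L=\{l_1,\ldots,l_k\}$ be a finite set of points in the tubular neighborhood of radius $s$ around $X$ such that for every $p\in X$ there exists $l_j\in L$ with $\|p-l_j\|<s$. Let $U=\bigcup_{j=1}^k B(l_j,\delta)$ be the union of the closed balls of $\mathbb{R}^m$ of radius $\delta$ centered at the $l_j$. Let $f_X,f_U$ be the restrictions of $f$ to $X$ and $U$, fix $i\in\mathbb{Z}$, and write $\beta_X=\beta_{(X,f_X,i)}$, $\beta_U=\beta_{(U,f_U,i)}$. Put $\omega(\delta+s)=(\Omega(\delta+s),\ldots,\Omega(\delta+s))\in\mathbb{R}^n$. (1) If $(u,v)\in\Delta^+$ and $u+\omega(\delta+s)\prec v-\omega(\delta+s)$, then $$\beta_U(u-\omega(\delta+s),v+\omega(\delta+s))\le\beta_X(u,v)\le\beta_U(u+\omega(\delta+s),v-\omega(\delta+s)).$$ (2) If $(\overline u,\overline v)\in\Delta^+$ is such that $\beta_X(\overline u,\overline v)\neq\beta_U(\overline u,\overline v)$, then there is at least one point $(\tilde u,\tilde v)$ with $\|(\overline u,\overline v)-(\tilde u,\tilde v)\|\le\Omega(\delta+s)$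 in the max norm, which is either an element of the boundary of $\Delta^+$ or a discontinuity point of $\beta_U$.
   Context: $\mathbb{R}^m$ carries the Euclidean norm; $\mathbb{R}^n$ (codomain of filtering functions) and $\mathbb{R}^n\times\mathbb{R}^n$ carry the max norm. For $u,v\in\mathbb{R}^n$, $u\prec v$ (resp. $u\preceq v$) means $u_j<v_j$ (resp. $u_j\le v_j$) for all $j=1,\ldots,n$. $\Delta^+=\{(u,v)\in\mathbb{R}^n\times\mathbb{R}^n : u\prec v\}$. Persistent Betti numbers: fix a field $\mathbb{K}$. A space is triangulable if it is homeomorphic to the underlying space of a finite simplicial complex (for a submanifold of a Euclidean space, also that its triangulation can be extended to a domain containing it). For a triangulable space $Z$, a continuous $f:Z\to\mathbb{R}^n$ and $i\in\mathbb{Z}$, let $Z\langle f\preceq u\rangle=\{p\in Z: f_j(p)\le u_j,\ j=1,\ldots,n\}$; then $\beta_{(Z,f,i)}:\Delta^+\to\mathbb{N}$ is defined by letting $\beta_{(Z,f,i)}(u,v)$ be the dimension of the image of the homomorphism $\check H_i(Z\langle f\preceq u\rangle)\to\check H_i(Z\langle f\preceq v\rangle)$ induced by inclusion, where $\check H_i$ is the $i$-th Čech homology with coefficients in $\mathbb{K}$. Discontinuity points of $\beta$ are those of the function $\beta:\Delta^+\to\mathbb{N}$ ($\mathbb{N}$ discrete). Modulus of continuity of $f:\mathbb{R}^m\to\mathbb{R}^n$: $\Omega(\varepsilon)=\max_{j}\sup\{|f_j(p)-f_j(p')| : p,p'\in\mathbb{R}^m,\ \|p-p'\|\le\varepsilon\}$.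 Condition number $1/\tau$: the open normal bundle to $X$ of radius $s$ is $\{(p,w): p\in X,\ w\in T_p\mathbb{R}^m \text{ orthogonal to } T_pX,\ \|w\|<s\}$, mapped to $\mathbb{R}^m$ by $(p,w)\mapsto p+w$; $\tau$ is the largest number such that for every $s<\tau$ this map is an embedding. For such $s$ the image is the tubular neighborhood of radius $s$ of $X$. *)

theory Defs
  imports "HOL-Analysis.Analysis" "HOL-Library.Poly_Mapping"
begin

section \<open>Simplicial homology with coefficients in a field\<close>

text \<open>
  An abstract simplicial complex is the set of its (nonempty, finite) simplices. Homology is that
  of the ordered chain complex: a simplex of degree \<open>i\<close> is a list of \<open>i + 1\<close> vertices, possibly with
  repetitions, that spans a simplex of \<open>K\<close>. Degrees are integers and there is no augmentation, so
  all groups of negative degree are zero.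
\<close>

definition ordered_simplices :: "'v set set \<Rightarrow> int \<Rightarrow> 'v list set" where
  "ordered_simplices K i = {\<sigma>. \<sigma> \<noteq> [] \<and> int (length \<sigma>) = i + 1 \<and> set \<sigma> \<in> K}"

definition chains :: "'v set set \<Rightarrow> int \<Rightarrow> ('v list \<Rightarrow>\<^sub>0 'k::field) set" where
  "chains K i = {c. Poly_Mapping.keys c \<subseteq> ordered_simplices K i}"

definition chain_scale :: "'k::field \<Rightarrow> ('x \<Rightarrow>\<^sub>0 'k) \<Rightarrow> ('x \<Rightarrow>\<^sub>0 'k)" where
  "chain_scale a = Poly_Mapping.map ((*) a)"

definition chain_extend :: "('x \<Rightarrow> ('y \<Rightarrow>\<^sub>0 'k)) \<Rightarrow> ('x \<Rightarrow>\<^sub>0 'k::field) \<Rightarrow> ('y \<Rightarrow>\<^sub>0 'k)" where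
  "chain_extend F c =
     (\<Sum>x\<in>Poly_Mapping.keys c. chain_scale (Poly_Mapping.lookup c x) (F x))"

definition simplex_boundary :: "'v list \<Rightarrow> ('v list \<Rightarrow>\<^sub>0 'k::field)" where
  "simplex_boundary \<sigma> =
     (if length \<sigma> \<le> 1 then 0
      else \<Sum>j<length \<sigma>. Poly_Mapping.single (take j \<sigma> @ drop (Suc j) \<sigma>) ((- 1) ^ j))"

definition cycles :: "'v set set \<Rightarrow> int \<Rightarrow> ('v list \<Rightarrow>\<^sub>0 'k::field) set" where
  "cycles K i = {c \<in> chains K i. chain_extend simplex_boundary c = 0}"

definition boundaries :: "'v set set \<Rightarrow> int \<Rightarrow> ('v list \<Rightarrow>\<^sub>0 'k::field) set" where
  "boundaries K i = chain_extend simplex_boundary ` chains K (i + 1)"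

definition homology_class ::
    "'v set set \<Rightarrow> int \<Rightarrow> ('v list \<Rightarrow>\<^sub>0 'k::field) \<Rightarrow> ('v list \<Rightarrow>\<^sub>0 'k) set" where
  "homology_class K i z = (\<lambda>b. z + b) ` boundaries K i"

definition homology :: "'v set set \<Rightarrow> int \<Rightarrow> ('v list \<Rightarrow>\<^sub>0 'k::field) set set" where
  "homology K i = homology_class K i ` cycles K i"

text \<open>
  The homomorphism into the homology of \<open>L\<close> induced by a simplicial map \<open>\<phi>\<close>. On a homology class
  \<open>C\<close>, the union below is the single class of the images of the representatives of \<open>C\<close>.
\<close>

definition homology_map ::
    "('v \<Rightarrow> 'w) \<Rightarrow> 'w set set \<Rightarrow> int \<Rightarrow> ('v list \<Rightarrow>\<^sub>0 'k::field) set \<Rightarrow> ('w list \<Rightarrow>\<^sub>0 'k) set" where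
  "homology_map \<phi> L i C =
     (\<Union>z\<in>C. homology_class L i (chain_extend (\<lambda>\<sigma>. Poly_Mapping.single (map \<phi> \<sigma>) 1) z))"

text \<open>
  The linear combination \<open>\<Sum>j\<in>J. a j \<cdot> C j\<close> of homology classes, computed on representatives.
\<close>

definition class_lincomb ::
    "'v set set \<Rightarrow> int \<Rightarrow> 'j set \<Rightarrow> ('j \<Rightarrow> 'k::field) \<Rightarrow> ('j \<Rightarrow> ('v list \<Rightarrow>\<^sub>0 'k) set)
      \<Rightarrow> ('v list \<Rightarrow>\<^sub>0 'k) set" where
  "class_lincomb K i J a C =
     (\<Union>z\<in>{z. \<forall>j\<in>J. z j \<in> C j}. homology_class K i (\<Sum>j\<in>J. chain_scale (a j) (z j)))"


section \<open>\v{C}ech homology of a subspace\<close>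

definition open_covers :: "'a::topological_space set \<Rightarrow> 'a set set set" where
  "open_covers Z = {\<U>. (\<forall>V\<in>\<U>. openin (top_of_set Z) V) \<and> \<Union>\<U> = Z}"

definition nerve :: "'a set set \<Rightarrow> 'a set set set" where
  "nerve \<U> = {\<sigma>. finite \<sigma> \<and> \<sigma> \<noteq> {} \<and> \<sigma> \<subseteq> \<U> \<and> \<Inter>\<sigma> \<noteq> {}}"

definition refinement_projection :: "'a set set \<Rightarrow> 'a set set \<Rightarrow> ('a set \<Rightarrow> 'a set) \<Rightarrow> bool" where
  "refinement_projection \<V> \<U> \<pi> \<longleftrightarrow> (\<forall>V\<in>\<V>. \<pi> V \<in> \<U> \<and> V \<subseteq> \<pi> V)"

text \<open>
  The inverse limit of the homology of the nerves of all open covers, directed by refinement.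
  Any two projections between the same covers are contiguous and induce the same map in homology,
  so quantifying over all of them agrees with choosing one.
\<close>

definition Cech_homology ::
    "'a::topological_space set \<Rightarrow> int \<Rightarrow> ('a set set \<Rightarrow> ('a set list \<Rightarrow>\<^sub>0 'k::field) set) set" where
  "Cech_homology Z i =
     {h \<in> (\<Pi>\<^sub>E \<U>\<in>open_covers Z. homology (nerve \<U>) i).
        \<forall>\<U>\<in>open_covers Z. \<forall>\<V>\<in>open_covers Z. \<forall>\<pi>.
          refinement_projection \<V> \<U> \<pi> \<longrightarrow> homology_map \<pi> (nerve \<U>) i (h \<V>) = h \<U>}"

text \<open>
  The map induced by an inclusion \<open>A \<subseteq> B\<close>. A cover \<open>\<U>\<close> of \<open>B\<close> restricts to the cover
  \<open>{A \<inter> V | V \<in> \<U>}\<close> of \<open>A\<close>, whose nerve is mapped to that of \<open>\<U>\<close> by choosing for every trace on \<open>A\<close>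
  a member of \<open>\<U>\<close> with this trace; different choices are contiguous.
\<close>

definition Cech_inclusion ::
    "'a::topological_space set \<Rightarrow> 'a set \<Rightarrow> int \<Rightarrow> ('a set set \<Rightarrow> ('a set list \<Rightarrow>\<^sub>0 'k::field) set)
      \<Rightarrow> ('a set set \<Rightarrow> ('a set list \<Rightarrow>\<^sub>0 'k) set)" where
  "Cech_inclusion A B i h =
     (\<lambda>\<U>\<in>open_covers B.
        homology_map (inv_into \<U> (\<lambda>V. A \<inter> V)) (nerve \<U>) i (h ((\<lambda>V. A \<inter> V) ` \<U>)))"

definition Cech_lincomb ::
    "'a::topological_space set \<Rightarrow> int \<Rightarrow> ('a set set \<Rightarrow> ('a set list \<Rightarrow>\<^sub>0 'k::field) set) set
      \<Rightarrow> (('a set set \<Rightarrow> ('a set list \<Rightarrow>\<^sub>0 'k) set) \<Rightarrow> 'k)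
      \<Rightarrow> ('a set set \<Rightarrow> ('a set list \<Rightarrow>\<^sub>0 'k) set)" where
  "Cech_lincomb Z i H a = (\<lambda>\<U>\<in>open_covers Z. class_lincomb (nerve \<U>) i H a (\<lambda>h. h \<U>))"

definition Cech_zero ::
    "'a::topological_space set \<Rightarrow> int \<Rightarrow> ('a set set \<Rightarrow> ('a set list \<Rightarrow>\<^sub>0 'k::field) set)" where
  "Cech_zero Z i = (\<lambda>\<U>\<in>open_covers Z. homology_class (nerve \<U>) i 0)"

definition Cech_independent ::
    "'a::topological_space set \<Rightarrow> int \<Rightarrow> ('a set set \<Rightarrow> ('a set list \<Rightarrow>\<^sub>0 'k::field) set) set \<Rightarrow> bool"
  where
  "Cech_independent Z i H \<longleftrightarrow>
     finite H \<and> (\<forall>a. Cech_lincomb Z i H a = Cech_zero Z i \<longrightarrow> (\<forall>h\<in>H. a h = 0))"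

text \<open>
  Dimension of a linear subspace \<open>S\<close> of the \v{C}ech homology of \<open>Z\<close>. It is \<open>\<infinity>\<close> (and not a
  conventional finite value) if \<open>S\<close> is infinite-dimensional.
\<close>

definition Cech_dim ::
    "'a::topological_space set \<Rightarrow> int \<Rightarrow> ('a set set \<Rightarrow> ('a set list \<Rightarrow>\<^sub>0 'k::field) set) set \<Rightarrow> enat"
  where
  "Cech_dim Z i S = (SUP H\<in>{H. H \<subseteq> S \<and> Cech_independent Z i H}. enat (card H))"


section \<open>Persistent Betti numbers\<close>

text \<open>
  The order on \<^typ>\<open>real ^ 'n\<close> is componentwise, but its strict part \<open>u < v\<close> only says
  \<open>u \<le> v\<close> and \<open>u \<noteq> v\<close>.
\<close>

definition strictly_below :: "real ^ 'n \<Rightarrow> real ^ 'n \<Rightarrow> bool" (infix "\<prec>" 50) where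
  "u \<prec> v \<longleftrightarrow> (\<forall>j. u $ j < v $ j)"

definition Delta_plus :: "((real ^ 'n) \<times> (real ^ 'n)) set" where
  "Delta_plus = {(u, v). u \<prec> v}"

definition sublevel :: "'a set \<Rightarrow> ('a \<Rightarrow> real ^ 'n) \<Rightarrow> real ^ 'n \<Rightarrow> 'a set" where
  "sublevel Z f u = {p \<in> Z. \<forall>j. f p $ j \<le> u $ j}"

text \<open>
  The type argument is the coefficient field. Only the values of \<open>f\<close> on \<open>Z\<close> matter.
\<close>

definition persistent_betti ::
    "'k::field itself \<Rightarrow> 'a::topological_space set \<Rightarrow> ('a \<Rightarrow> real ^ 'n) \<Rightarrow> int
      \<Rightarrow> (real ^ 'n) \<times> (real ^ 'n) \<Rightarrow> enat" where
  "persistent_betti _ Z f i = (\<lambda>(u, v).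
     Cech_dim (sublevel Z f v) i
       (Cech_inclusion (sublevel Z f u) (sublevel Z f v) i `
          (Cech_homology (sublevel Z f u) i ::
             ('a set set \<Rightarrow> ('a set list \<Rightarrow>\<^sub>0 'k) set) set)))"

text \<open>
  The codomain carries the discrete topology (which differs from the library's topology on
  \<^typ>\<open>enat\<close> at \<open>\<infinity>\<close> only), the domain is \<open>\<Delta>\<^sup>+\<close>.
\<close>

definition discontinuity_point ::
    "((real ^ 'n) \<times> (real ^ 'n) \<Rightarrow> enat) \<Rightarrow> (real ^ 'n) \<times> (real ^ 'n) \<Rightarrow> bool" where
  "discontinuity_point \<beta> p \<longleftrightarrow>
     p \<in> Delta_plus \<and> \<not> limitin (discrete_topology UNIV) \<beta> (\<beta> p) (at p within Delta_plus)"

text \<open>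
  The modulus of continuity is infinite at \<open>\<epsilon>\<close> if the oscillations at scale \<open>\<epsilon>\<close> are unbounded.
\<close>

definition modulus_of_continuity :: "(real ^ 'm \<Rightarrow> real ^ 'n) \<Rightarrow> real \<Rightarrow> ereal" where
  "modulus_of_continuity f \<epsilon> =
     (MAX j. SUP (p, p') \<in> {(p, p'). norm (p - p') \<le> \<epsilon>}. ereal \<bar>f p $ j - f p' $ j\<bar>)"


section \<open>Submanifolds of Euclidean space\<close>

primrec Ck_on ::
    "nat \<Rightarrow> 'a::real_normed_vector set \<Rightarrow> ('a \<Rightarrow> 'b::real_normed_vector) \<Rightarrow> bool" where
  "Ck_on 0 W f \<longleftrightarrow> continuous_on W f"
| "Ck_on (Suc k) W f \<longleftrightarrow>
     (\<forall>x\<in>W. f differentiable (at x)) \<and> (\<forall>v. Ck_on k W (\<lambda>x. frechet_derivative f (at x) v))"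

text \<open>To be used for open \<open>W\<close> in a finite-dimensional space.\<close>

definition smooth_on ::
    "'a::real_normed_vector set \<Rightarrow> ('a \<Rightarrow> 'b::real_normed_vector) \<Rightarrow> bool" where
  "smooth_on W f \<longleftrightarrow> (\<forall>k. Ck_on k W f)"

definition smooth_submanifold :: "'a::euclidean_space set \<Rightarrow> nat \<Rightarrow> bool" where
  "smooth_submanifold X d \<longleftrightarrow>
     (\<forall>p\<in>X. \<exists>W V \<phi> \<psi>. \<exists>E :: 'a set.
        open W \<and> p \<in> W \<and> open V \<and> homeomorphism W V \<phi> \<psi> \<and> smooth_on W \<phi> \<and> smooth_on V \<psi> \<and>
        subspace E \<and> dim E = d \<and> \<phi> ` (W \<inter> X) = V \<inter> E)"

text \<open>Velocities at \<open>p\<close> of smooth curves in \<open>X\<close>.\<close>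

definition tangent_space :: "'a::euclidean_space set \<Rightarrow> 'a \<Rightarrow> 'a set" where
  "tangent_space X p =
     {v. \<exists>\<gamma> e. e > 0 \<and> smooth_on {-e<..<e} \<gamma> \<and> \<gamma> ` {-e<..<e} \<subseteq> X \<and> \<gamma> 0 = p \<and>
           (\<gamma> has_vector_derivative v) (at 0)}"

text \<open>
  Smooth embedding of a submanifold \<open>N\<close>, for a map given on the ambient space: an immersion that is
  a homeomorphism onto its image.
\<close>

definition smooth_embedding ::
    "'a::euclidean_space set \<Rightarrow> ('a \<Rightarrow> 'b::euclidean_space) \<Rightarrow> bool" where
  "smooth_embedding N F \<longleftrightarrow>
     (\<exists>W. open W \<and> N \<subseteq> W \<and> smooth_on W F) \<and>
     (\<forall>x\<in>N. inj_on (frechet_derivative F (at x)) (tangent_space N x)) \<and>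
     embedding_map (top_of_set N) euclidean F"

definition open_normal_bundle :: "'a::euclidean_space set \<Rightarrow> real \<Rightarrow> ('a \<times> 'a) set" where
  "open_normal_bundle X s =
     {(p, w). p \<in> X \<and> (\<forall>v\<in>tangent_space X p. orthogonal w v) \<and> norm w < s}"

definition tubular_neighborhood :: "'a::euclidean_space set \<Rightarrow> real \<Rightarrow> 'a set" where
  "tubular_neighborhood X s = (\<lambda>(p, w). p + w) ` open_normal_bundle X s"

text \<open>
  The condition number of \<open>X\<close> is \<open>1 / \<tau>\<close>. No real \<open>\<tau>\<close> qualifies if arbitrarily large radii are
  admissible, as for a single point.
\<close>

definition has_condition_number_inverse :: "'a::euclidean_space set \<Rightarrow> real \<Rightarrow> bool" where
  "has_condition_number_inverse X \<tau> \<longleftrightarrow>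
     (let admissible = {t. \<forall>s<t. smooth_embedding (open_normal_bundle X s) (\<lambda>(p, w). p + w)}
      in \<tau> \<in> admissible \<and> (\<forall>t\<in>admissible. t \<le> \<tau>))"


section \<open>Triangulability\<close>

text \<open>
  Finite simplicial complexes and their underlying spaces are given by abstract complexes and
  barycentric coordinates, so that the dimension of the space in which a complex lives is not
  restricted by a type.
\<close>

definition finite_complex :: "nat set set \<Rightarrow> bool" where
  "finite_complex K \<longleftrightarrow>
     finite K \<and> (\<forall>\<sigma>\<in>K. finite \<sigma> \<and> \<sigma> \<noteq> {} \<and> (\<forall>\<rho>. \<rho> \<subseteq> \<sigma> \<and> \<rho> \<noteq> {} \<longrightarrow> \<rho> \<in> K))"

definition underlying_space :: "nat set set \<Rightarrow> (nat \<Rightarrow> real) set" where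
  "underlying_space K =
     {t. (\<forall>v. 0 \<le> t v) \<and> {v. t v \<noteq> 0} \<in> K \<and> (\<Sum>v | t v \<noteq> 0. t v) = 1}"

text \<open>
  A triangulation of \<open>X\<close> extends to a (closed, connected) domain containing \<open>X\<close> in its interior if
  the domain has a triangulation in which \<open>X\<close> is triangulated by a subcomplex.
\<close>

definition triangulable_submanifold :: "'a::euclidean_space set \<Rightarrow> bool" where
  "triangulable_submanifold X \<longleftrightarrow>
     (\<exists>K K' G h h'. finite_complex K \<and> finite_complex K' \<and> K' \<subseteq> K \<and>
        open G \<and> connected G \<and> X \<subseteq> G \<and>
        homeomorphism (underlying_space K) (closure G) h h' \<and> h ` underlying_space K' = X)"

end

theory Submission
  imports Defs
begin

text \<open>
  Contiguous maps of nerves are chain homotopic through the prism operator. So a continuous map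
  induces a map of \v{C}ech homology whose value at a cover can be read off from any sufficiently
  fine cover of the source; two maps that are close with respect to a cover agree at it, and
  subdividing a homotopy on a compact space gives homotopy invariance.

  Injectivity of the normal bundle map below radius \<open>\<tau>\<close> makes nearest points on \<open>X\<close> unique within
  distance \<open>\<tau>\<close> and keeps \<open>X\<close> out of the open balls of radius \<open>\<tau>\<close> tangent to it. The bounds on \<open>\<delta>\<close> then
  force the segment from a point of \<open>U\<close> to its nearest point on \<open>X\<close> to stay in \<open>U\<close>, so \<open>U\<close> retracts
  onto \<open>X\<close> moving points by at most \<open>\<delta> + s\<close>. Up to homotopy, inclusions of sublevel sets of one of
  the two spaces factor through those of the other, which gives the rank inequalities. For the
  second part, \<open>\<beta>\<^sub>U\<close> without discontinuities is constant on the max-norm ball around the point, which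
  is connected and lies in \<open>\<Delta>\<^sup>+\<close> if it misses the frontier.
\<close>

section \<open>Chains\<close>

lemma lookup_chain_scale [simp]:
  "Poly_Mapping.lookup (chain_scale a c) x = a * Poly_Mapping.lookup c x"
  by (simp add: chain_scale_def Poly_Mapping.map.rep_eq when_def)

lemma chain_scale_add: "chain_scale a (c + d) = chain_scale a c + chain_scale a d"
  by (rule poly_mapping_eqI) (simp add: lookup_add algebra_simps)

lemma chain_scale_diff: "chain_scale a (c - d) = chain_scale a c - chain_scale a d"
  by (rule poly_mapping_eqI) (simp add: lookup_minus algebra_simps)

lemma chain_scale_one [simp]: "chain_scale 1 c = c"
  by (rule poly_mapping_eqI) simp

lemma keys_chain_scale: "Poly_Mapping.keys (chain_scale a c) \<subseteq> Poly_Mapping.keys c"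
  by (auto simp: in_keys_iff)

lemma chain_scale_single: "chain_scale a (Poly_Mapping.single x b) = Poly_Mapping.single x (a * b)"
  by (rule poly_mapping_eqI) (simp add: lookup_single when_def)

text \<open>The index set may exceed the support, so that chains with different supports can be
  compared as sums over one set.\<close>

lemma lookup_chain_extend:
  assumes "finite S" "Poly_Mapping.keys c \<subseteq> S"
  shows "Poly_Mapping.lookup (chain_extend F c) y =
    (\<Sum>x\<in>S. Poly_Mapping.lookup c x * Poly_Mapping.lookup (F x) y)"
proof -
  have "Poly_Mapping.lookup (chain_extend F c) y =
      (\<Sum>x\<in>Poly_Mapping.keys c. Poly_Mapping.lookup c x * Poly_Mapping.lookup (F x) y)"
    by (simp add: chain_extend_def lookup_sum)
  also have "\<dots> = (\<Sum>x\<in>S. Poly_Mapping.lookup c x * Poly_Mapping.lookup (F x) y)"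
    using assms by (intro sum.mono_neutral_left) (auto simp: in_keys_iff)
  finally show ?thesis .
qed

lemma chain_extend_cong:
  assumes "\<And>x. x \<in> Poly_Mapping.keys c \<Longrightarrow> F x = G x"
  shows "chain_extend F c = chain_extend G c"
  using assms by (simp add: chain_extend_def)

lemma chain_extend_zero [simp]: "chain_extend F 0 = 0"
  by (simp add: chain_extend_def)

lemma chain_extend_single [simp]:
  "chain_extend F (Poly_Mapping.single x a) = chain_scale a (F x)"
  by (rule poly_mapping_eqI) (simp add: lookup_chain_extend[of "{x}"])

lemma chain_extend_add: "chain_extend F (c + d) = chain_extend F c + chain_extend F d"
proof (rule poly_mapping_eqI)
  fix y
  let ?S = "Poly_Mapping.keys c \<union> Poly_Mapping.keys d"
  show "Poly_Mapping.lookup (chain_extend F (c + d)) y =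
      Poly_Mapping.lookup (chain_extend F c + chain_extend F d) y"
    using Poly_Mapping.keys_add[of c d]
    by (simp add: lookup_add lookup_chain_extend[of ?S] sum.distrib algebra_simps)
qed

lemma chain_extend_scale: "chain_extend F (chain_scale a c) = chain_scale a (chain_extend F c)"
  using keys_chain_scale[of a c]
  by (intro poly_mapping_eqI)
     (simp add: lookup_chain_extend[of "Poly_Mapping.keys c"] sum_distrib_left mult.assoc)

lemma chain_extend_diff: "chain_extend F (c - d) = chain_extend F c - chain_extend F d"
  using chain_extend_add[of F "c - d" d] by (simp add: algebra_simps)

lemma chain_extend_sum: "chain_extend F (\<Sum>j\<in>J. c j) = (\<Sum>j\<in>J. chain_extend F (c j))"
  by (induction J rule: infinite_finite_induct) (simp_all add: chain_extend_add)

lemma chain_extend_chain_extend: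
  "chain_extend G (chain_extend F c) = chain_extend (\<lambda>x. chain_extend G (F x)) c"
  by (simp add: chain_extend_def[of F] chain_extend_def[of "\<lambda>x. chain_extend G (F x)"]
      chain_extend_sum chain_extend_scale)

lemma chain_extend_add_fun:
  "chain_extend (\<lambda>x. F x + G x) c = chain_extend F c + chain_extend G c"
  by (simp add: chain_extend_def chain_scale_add sum.distrib)

lemma chain_extend_diff_fun:
  "chain_extend (\<lambda>x. F x - G x) c = chain_extend F c - chain_extend G c"
  by (simp add: chain_extend_def chain_scale_diff sum_subtractf)

lemma chain_extend_id [simp]: "chain_extend (\<lambda>x. Poly_Mapping.single x 1) c = c"
proof (rule poly_mapping_eqI)
  fix y
  have "Poly_Mapping.lookup (chain_extend (\<lambda>x. Poly_Mapping.single x 1) c) y =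
      (\<Sum>x\<in>insert y (Poly_Mapping.keys c). Poly_Mapping.lookup c x * (1 when x = y))"
    by (subst lookup_chain_extend[of "insert y (Poly_Mapping.keys c)"])
       (auto simp: lookup_single)
  also have "\<dots> = (\<Sum>x\<in>insert y (Poly_Mapping.keys c). if x = y then Poly_Mapping.lookup c x else 0)"
    by (intro sum.cong) (auto simp: when_def)
  also have "\<dots> = Poly_Mapping.lookup c y"
    by (simp add: sum.delta')
  finally show "Poly_Mapping.lookup (chain_extend (\<lambda>x. Poly_Mapping.single x 1) c) y =
      Poly_Mapping.lookup c y" .
qed

lemma keys_chain_extend:
  "Poly_Mapping.keys (chain_extend F c) \<subseteq>
    (\<Union>x\<in>Poly_Mapping.keys c. Poly_Mapping.keys (F x))"
proof
  fix y assume "y \<in> Poly_Mapping.keys (chain_extend F c)"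
  then have "(\<Sum>x\<in>Poly_Mapping.keys c. Poly_Mapping.lookup c x * Poly_Mapping.lookup (F x) y) \<noteq> 0"
    by (simp add: in_keys_iff lookup_chain_extend[of "Poly_Mapping.keys c"])
  then obtain x where "x \<in> Poly_Mapping.keys c"
      "Poly_Mapping.lookup c x * Poly_Mapping.lookup (F x) y \<noteq> 0"
    by (meson sum.neutral)
  then show "y \<in> (\<Union>x\<in>Poly_Mapping.keys c. Poly_Mapping.keys (F x))"
    by (auto simp: in_keys_iff)
qed

section \<open>Chain maps, cycles and boundaries\<close>

abbreviation chain_map :: "('v \<Rightarrow> 'w) \<Rightarrow> ('v list \<Rightarrow>\<^sub>0 'k::field) \<Rightarrow> ('w list \<Rightarrow>\<^sub>0 'k)" where
  "chain_map \<phi> \<equiv> chain_extend (\<lambda>\<sigma>. Poly_Mapping.single (map \<phi> \<sigma>) 1)"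

lemma chain_map_chain_map: "chain_map \<psi> (chain_map \<phi> c) = chain_map (\<psi> \<circ> \<phi>) c"
  by (simp add: chain_extend_chain_extend)

lemma chains_add: "c \<in> chains K i \<Longrightarrow> d \<in> chains K i \<Longrightarrow> c + d \<in> chains K i"
  using Poly_Mapping.keys_add[of c d] by (auto simp: chains_def)

lemma chains_scale: "c \<in> chains K i \<Longrightarrow> chain_scale a c \<in> chains K i"
  using keys_chain_scale[of a c] by (auto simp: chains_def)

text \<open>Ordered simplices may repeat vertices, so a vertex map that collapses a simplex still
  yields one of the same degree and needs no separate case.\<close>

lemma chain_map_chains:
  assumes "\<And>\<sigma>. \<sigma> \<in> K \<Longrightarrow> \<phi> ` \<sigma> \<in> L" "c \<in> chains K i"
  shows "chain_map \<phi> c \<in> chains L i"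
proof -
  have "Poly_Mapping.keys (chain_map \<phi> c) \<subseteq> map \<phi> ` Poly_Mapping.keys c"
    using keys_chain_extend[of "\<lambda>\<sigma>. Poly_Mapping.single (map \<phi> \<sigma>) 1" c] by (auto split: if_splits)
  then show ?thesis
    using assms by (fastforce simp: chains_def ordered_simplices_def)
qed

lemma chain_map_simplex_boundary:
  "chain_map \<phi> (simplex_boundary \<sigma>) = (simplex_boundary (map \<phi> \<sigma>) :: _ \<Rightarrow>\<^sub>0 'k::field)"
  by (simp add: simplex_boundary_def chain_extend_sum chain_scale_single take_map drop_map)

lemma boundary_chain_map:
  "chain_extend simplex_boundary (chain_map \<phi> c) = chain_map \<phi> (chain_extend simplex_boundary c)"
  by (simp add: chain_extend_chain_extend chain_map_simplex_boundary)

lemma chain_map_cycles: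
  assumes "\<And>\<sigma>. \<sigma> \<in> K \<Longrightarrow> \<phi> ` \<sigma> \<in> L" "c \<in> cycles K i"
  shows "chain_map \<phi> c \<in> cycles L i"
  using assms chain_map_chains[of K \<phi> L c i] by (simp add: cycles_def boundary_chain_map)

lemma chain_map_boundaries:
  assumes "\<And>\<sigma>. \<sigma> \<in> K \<Longrightarrow> \<phi> ` \<sigma> \<in> L" "b \<in> boundaries K i"
  shows "chain_map \<phi> b \<in> boundaries L i"
proof -
  obtain c where c: "c \<in> chains K (i + 1)" "b = chain_extend simplex_boundary c"
    using assms(2) by (auto simp: boundaries_def)
  have "chain_map \<phi> c \<in> chains L (i + 1)"
    using assms(1) c(1) by (rule chain_map_chains)
  then show ?thesis
    unfolding c(2) boundaries_def boundary_chain_map[symmetric] by (rule imageI)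
qed

lemma boundaries_zero: "0 \<in> boundaries K i"
  by (auto simp: boundaries_def chains_def intro!: image_eqI[of _ _ 0])

lemma boundaries_add: "b \<in> boundaries K i \<Longrightarrow> b' \<in> boundaries K i \<Longrightarrow> b + b' \<in> boundaries K i"
  by (auto simp: boundaries_def chains_add simp flip: chain_extend_add)

lemma boundaries_scale: "b \<in> boundaries K i \<Longrightarrow> chain_scale a b \<in> boundaries K i"
  by (auto simp: boundaries_def chains_scale simp flip: chain_extend_scale)

lemma boundaries_minus:
  assumes "b \<in> boundaries K i"
  shows "- b \<in> boundaries K i"
proof -
  have "- b = chain_scale (- 1) b"
    by (rule poly_mapping_eqI) simp
  then show ?thesis
    using assms by (simp add: boundaries_scale)
qed

lemma boundaries_sum:
  "(\<And>j. j \<in> J \<Longrightarrow> b j \<in> boundaries K i) \<Longrightarrow> (\<Sum>j\<in>J. b j) \<in> boundaries K i"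
  by (induction J rule: infinite_finite_induct) (simp_all add: boundaries_zero boundaries_add)


section \<open>Homology classes and contiguous maps\<close>

lemma mem_homology_class: "w \<in> homology_class K i z \<longleftrightarrow> w - z \<in> boundaries K i"
  by (auto simp: homology_class_def algebra_simps intro: image_eqI[of _ _ "w - z"])

lemma homology_class_eqI:
  assumes "z - w \<in> boundaries K i"
  shows "homology_class K i z = homology_class K i w"
proof (rule set_eqI)
  fix x
  have "x - w = (x - z) + (z - w)" "x - z = (x - w) + - (z - w)"
    by simp_all
  then show "x \<in> homology_class K i z \<longleftrightarrow> x \<in> homology_class K i w"
    unfolding mem_homology_class using assms boundaries_add boundaries_minus by metis
qed

text \<open>Representatives differ by boundaries, which a simplicial map sends to boundaries; all
  members of the union in \<open>homology_map\<close> are therefore one class.\<close>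

lemma homology_map_class:
  assumes "\<And>\<sigma>. \<sigma> \<in> K \<Longrightarrow> \<phi> ` \<sigma> \<in> L"
  shows "homology_map \<phi> L i (homology_class K i z) = homology_class L i (chain_map \<phi> z)"
proof -
  have "homology_class L i (chain_map \<phi> w) = homology_class L i (chain_map \<phi> z)"
    if "w \<in> homology_class K i z" for w
    using that assms chain_map_boundaries[of K \<phi> L "w - z" i]
    by (intro homology_class_eqI) (simp add: mem_homology_class chain_extend_diff)
  moreover have "z \<in> homology_class K i z"
    by (simp add: mem_homology_class boundaries_zero)
  ultimately show ?thesis
    unfolding homology_map_def by blast
qed

lemma homology_map_in_homology:
  assumes "\<And>\<sigma>. \<sigma> \<in> K \<Longrightarrow> \<phi> ` \<sigma> \<in> L" "C \<in> homology K i"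
  shows "homology_map \<phi> L i C \<in> homology L i"
proof -
  obtain z where z: "z \<in> cycles K i" "C = homology_class K i z"
    using assms(2) by (auto simp: homology_def)
  have "chain_map \<phi> z \<in> cycles L i"
    using assms(1) z(1) by (rule chain_map_cycles)
  moreover have "homology_map \<phi> L i C = homology_class L i (chain_map \<phi> z)"
    unfolding z(2) using assms(1) by (rule homology_map_class)
  ultimately show ?thesis
    by (simp add: homology_def)
qed

lemma homology_map_comp:
  assumes "\<And>\<sigma>. \<sigma> \<in> K \<Longrightarrow> \<phi> ` \<sigma> \<in> L" "\<And>\<sigma>. \<sigma> \<in> L \<Longrightarrow> \<psi> ` \<sigma> \<in> M" "C \<in> homology K i"
  shows "homology_map \<psi> M i (homology_map \<phi> L i C) = homology_map (\<psi> \<circ> \<phi>) M i C"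
proof -
  have M: "(\<psi> \<circ> \<phi>) ` \<sigma> \<in> M" if "\<sigma> \<in> K" for \<sigma>
    using assms that by (metis image_comp)
  obtain z where z: "C = homology_class K i z"
    using assms(3) by (auto simp: homology_def)
  have "homology_map \<psi> M i (homology_map \<phi> L i C) =
      homology_map \<psi> M i (homology_class L i (chain_map \<phi> z))"
    using assms(1) by (simp add: z homology_map_class[of K \<phi> L])
  also have "\<dots> = homology_class M i (chain_map \<psi> (chain_map \<phi> z))"
    using assms(2) by (rule homology_map_class)
  also have "\<dots> = homology_map (\<psi> \<circ> \<phi>) M i C"
    unfolding z chain_map_chain_map using M by (rule homology_map_class[symmetric])
  finally show ?thesis .
qed

lemma class_lincomb_class:
  assumes "\<And>j. j \<in> J \<Longrightarrow> C j = homology_class K i (z j)"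
  shows "class_lincomb K i J a C = homology_class K i (\<Sum>j\<in>J. chain_scale (a j) (z j))"
proof -
  have "homology_class K i (\<Sum>j\<in>J. chain_scale (a j) (w j)) =
      homology_class K i (\<Sum>j\<in>J. chain_scale (a j) (z j))"
    if "\<forall>j\<in>J. w j \<in> C j" for w
    using that assms
    by (intro homology_class_eqI)
       (auto simp: mem_homology_class simp flip: sum_subtractf chain_scale_diff
             intro!: boundaries_sum boundaries_scale)
  moreover have "\<forall>j\<in>J. z j \<in> C j"
    using assms by (simp add: mem_homology_class boundaries_zero)
  ultimately show ?thesis
    unfolding class_lincomb_def by blast
qed

section \<open>The prism operator and contiguous maps\<close>

abbreviation cons_chain :: "'v \<Rightarrow> ('v list \<Rightarrow>\<^sub>0 'k::field) \<Rightarrow> ('v list \<Rightarrow>\<^sub>0 'k)" where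
  "cons_chain v \<equiv> chain_extend (\<lambda>\<sigma>. Poly_Mapping.single (v # \<sigma>) 1)"

text \<open>With the empty list as the simplex of degree \<open>-1\<close>, boundary and prism operator satisfy plain
  recursions, and the homotopy formula follows by induction on the list.\<close>

primrec augmented_boundary :: "'v list \<Rightarrow> ('v list \<Rightarrow>\<^sub>0 'k::field)" where
  "augmented_boundary [] = 0"
| "augmented_boundary (v # \<sigma>) = Poly_Mapping.single \<sigma> 1 - cons_chain v (augmented_boundary \<sigma>)"

primrec prism :: "('v \<Rightarrow> 'w) \<Rightarrow> ('v \<Rightarrow> 'w) \<Rightarrow> 'v list \<Rightarrow> ('w list \<Rightarrow>\<^sub>0 'k::field)" where
  "prism \<phi> \<psi> [] = 0"
| "prism \<phi> \<psi> (v # \<sigma>) =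
     Poly_Mapping.single (\<phi> v # \<psi> v # map \<psi> \<sigma>) 1 - cons_chain (\<phi> v) (prism \<phi> \<psi> \<sigma>)"

text \<open>Dropping the head gives the first face; every other face keeps the head and has its
  index shifted by one, which is the minus sign of the recursion.\<close>

lemma augmented_boundary_eq:
  "augmented_boundary \<sigma> =
    (\<Sum>j<length \<sigma>. Poly_Mapping.single (take j \<sigma> @ drop (Suc j) \<sigma>) ((- 1) ^ j) :: _ \<Rightarrow>\<^sub>0 'k::field)"
proof (induction \<sigma>)
  case (Cons v \<sigma>)
  have "cons_chain v (augmented_boundary \<sigma>) =
      (\<Sum>j<length \<sigma>. Poly_Mapping.single (v # take j \<sigma> @ drop (Suc j) \<sigma>) ((- 1) ^ j) :: _ \<Rightarrow>\<^sub>0 'k)"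
    by (simp add: Cons chain_extend_sum chain_scale_single)
  then show ?case
    by (simp add: sum.lessThan_Suc_shift single_uminus sum_negf del: sum.lessThan_Suc)
qed simp

text \<open>The two differ only on a single vertex, whose augmented boundary is the empty list
  instead of zero.\<close>

lemma simplex_boundary_eq:
  "simplex_boundary \<sigma> = (if length \<sigma> \<le> 1 then 0 else augmented_boundary \<sigma>)"
  by (simp add: simplex_boundary_def augmented_boundary_eq)

text \<open>The cone formula. The augmentation makes it valid down to the cone over the empty
  list.\<close>

lemma augmented_boundary_cons_chain:
  "chain_extend augmented_boundary (cons_chain v c) =
    c - cons_chain v (chain_extend augmented_boundary c)"
  by (simp add: chain_extend_chain_extend chain_extend_diff_fun)

lemma prism_cons_chain:
  "chain_extend (prism \<phi> \<psi>) (cons_chain v c) =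
    cons_chain (\<phi> v) (cons_chain (\<psi> v) (chain_map \<psi> c)) -
    cons_chain (\<phi> v) (chain_extend (prism \<phi> \<psi>) c)"
  by (simp add: chain_extend_chain_extend chain_extend_diff_fun)

lemma augmented_boundary_map:
  "augmented_boundary (map \<psi> \<sigma>) = chain_map \<psi> (augmented_boundary \<sigma>)"
  by (simp add: augmented_boundary_eq chain_extend_sum chain_scale_single take_map drop_map)

lemma augmented_boundary_prism:
  "chain_extend augmented_boundary (prism \<phi> \<psi> \<sigma>) +
     chain_extend (prism \<phi> \<psi>) (augmented_boundary \<sigma>) =
   (Poly_Mapping.single (map \<psi> \<sigma>) 1 - Poly_Mapping.single (map \<phi> \<sigma>) 1 :: _ \<Rightarrow>\<^sub>0 'k::field)"
proof (induction \<sigma>)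
  case (Cons v \<sigma>)
  let ?E = "chain_extend augmented_boundary :: _ \<Rightarrow> (_ \<Rightarrow>\<^sub>0 'k)"
  \<comment> \<open>The induction hypothesis, coned from \<open>\<phi> v\<close>. Its positive term
    cancels the mixed simplex \<open>\<phi> v # map \<psi> \<sigma>\<close> in the boundary of the
    leading prism term.\<close>
  have "cons_chain (\<phi> v) (?E (prism \<phi> \<psi> \<sigma>)) +
      cons_chain (\<phi> v) (chain_extend (prism \<phi> \<psi>) (augmented_boundary \<sigma>)) =
      Poly_Mapping.single (\<phi> v # map \<psi> \<sigma>) 1 - Poly_Mapping.single (\<phi> v # map \<phi> \<sigma>) (1::'k)"
    by (simp flip: chain_extend_add add: Cons chain_extend_diff)
  then show ?case
    by (simp add: chain_extend_diff augmented_boundary_cons_chain prism_cons_chain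
        augmented_boundary_map algebra_simps)
qed simp

text \<open>The bound \<open>1 < length \<rho>\<close> is recorded because the two boundary
  operators agree on such lists; the empty list has prism zero and contributes nothing.\<close>

lemma keys_prism:
  "\<rho> \<in> Poly_Mapping.keys (prism \<phi> \<psi> \<sigma> :: _ \<Rightarrow>\<^sub>0 'k::field) \<Longrightarrow>
    length \<rho> = Suc (length \<sigma>) \<and> 1 < length \<rho> \<and> set \<rho> \<subseteq> \<phi> ` set \<sigma> \<union> \<psi> ` set \<sigma>"
proof (induction \<sigma> arbitrary: \<rho>)
  case (Cons v \<sigma>)
  let ?F = "\<lambda>\<sigma>. Poly_Mapping.single (\<phi> v # \<sigma>) (1::'k)"
  have "\<rho> \<in> Poly_Mapping.keys (Poly_Mapping.single (\<phi> v # \<psi> v # map \<psi> \<sigma>) (1::'k)) \<union>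
      Poly_Mapping.keys (cons_chain (\<phi> v) (prism \<phi> \<psi> \<sigma> :: _ \<Rightarrow>\<^sub>0 'k))"
    using Cons.prems keys_diff by fastforce
  then consider "\<rho> = \<phi> v # \<psi> v # map \<psi> \<sigma>"
    | \<rho>' where "\<rho> = \<phi> v # \<rho>'" "\<rho>' \<in> Poly_Mapping.keys (prism \<phi> \<psi> \<sigma> :: _ \<Rightarrow>\<^sub>0 'k)"
    using keys_chain_extend[of ?F "prism \<phi> \<psi> \<sigma>"] by (auto split: if_splits)
  then show ?case
  proof cases
    case 2
    then show ?thesis using Cons.IH[of \<rho>'] by auto
  qed auto
qed simp

lemma boundary_prism:
  "chain_extend simplex_boundary (prism \<phi> \<psi> \<sigma>) + chain_extend (prism \<phi> \<psi>) (simplex_boundary \<sigma>) =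
   (Poly_Mapping.single (map \<psi> \<sigma>) 1 - Poly_Mapping.single (map \<phi> \<sigma>) 1 :: _ \<Rightarrow>\<^sub>0 'k::field)"
proof -
  have "chain_extend simplex_boundary (prism \<phi> \<psi> \<sigma> :: _ \<Rightarrow>\<^sub>0 'k) =
      chain_extend augmented_boundary (prism \<phi> \<psi> \<sigma>)"
    using keys_prism by (intro chain_extend_cong) (fastforce simp: simplex_boundary_eq)
  \<comment> \<open>On a single vertex the two boundaries differ by the empty list, whose prism is
    zero.\<close>
  moreover have "chain_extend (prism \<phi> \<psi>) (simplex_boundary \<sigma>) =
      (chain_extend (prism \<phi> \<psi>) (augmented_boundary \<sigma>) :: _ \<Rightarrow>\<^sub>0 'k)"
    by (cases \<sigma>) (auto simp: simplex_boundary_eq)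
  ultimately show ?thesis
    using augmented_boundary_prism by metis
qed

text \<open>The prism operator is a chain homotopy, and contiguity puts the vertices of each prism
  simplex into one simplex of \<open>L\<close>. Excluding the empty simplex makes the images under
  each single map nonempty faces of that simplex.\<close>

lemma homology_map_contiguous:
  assumes contiguous: "\<And>\<sigma>. \<sigma> \<in> K \<Longrightarrow> \<phi> ` \<sigma> \<union> \<psi> ` \<sigma> \<in> L"
    and faces: "\<And>\<sigma> \<rho>. \<sigma> \<in> L \<Longrightarrow> \<rho> \<subseteq> \<sigma> \<Longrightarrow> \<rho> \<noteq> {} \<Longrightarrow> \<rho> \<in> L"
    and nonempty: "{} \<notin> K"
    and C: "C \<in> homology K i"
  shows "homology_map \<phi> L i C = homology_map \<psi> L i (C :: ('v list \<Rightarrow>\<^sub>0 'k::field) set)"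
proof -
  obtain z where z: "z \<in> cycles K i" and C: "C = homology_class K i z"
    using C by (auto simp: homology_def)
  have simplicial: "\<phi> ` \<sigma> \<in> L" "\<psi> ` \<sigma> \<in> L" if "\<sigma> \<in> K" for \<sigma>
    using that nonempty by (auto intro!: faces[OF contiguous[OF that]])
  let ?P = "chain_extend (prism \<phi> \<psi>) :: _ \<Rightarrow> (_ \<Rightarrow>\<^sub>0 'k)"
  have "chain_extend simplex_boundary (?P z) + ?P (chain_extend simplex_boundary z) =
      chain_map \<psi> z - chain_map \<phi> z"
    by (simp add: chain_extend_chain_extend boundary_prism
        flip: chain_extend_add_fun chain_extend_diff_fun)
  \<comment> \<open>On a cycle the second term of the homotopy formula vanishes.\<close>
  then have eq: "chain_map \<psi> z - chain_map \<phi> z = chain_extend simplex_boundary (?P z)"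
    using z by (simp add: cycles_def)
  have "?P z \<in> chains L (i + 1)"
    unfolding chains_def
  proof (intro CollectI subsetI)
    fix \<rho> assume "\<rho> \<in> Poly_Mapping.keys (?P z)"
    then obtain \<sigma> where \<sigma>: "\<sigma> \<in> Poly_Mapping.keys z"
        and "\<rho> \<in> Poly_Mapping.keys (prism \<phi> \<psi> \<sigma> :: _ \<Rightarrow>\<^sub>0 'k)"
      using keys_chain_extend[of "prism \<phi> \<psi>" z] by auto
    then have \<rho>: "length \<rho> = Suc (length \<sigma>)" "set \<rho> \<subseteq> \<phi> ` set \<sigma> \<union> \<psi> ` set \<sigma>"
      using keys_prism by blast+
    have "set \<sigma> \<in> K" "int (length \<sigma>) = i + 1"
      using \<sigma> z by (auto simp: cycles_def chains_def ordered_simplices_def)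
    moreover have "\<rho> \<noteq> []"
      using \<rho>(1) by auto
    ultimately show "\<rho> \<in> ordered_simplices L (i + 1)"
      using \<rho> faces[OF contiguous[of "set \<sigma>"], of "set \<rho>"]
      by (simp add: ordered_simplices_def)
  qed
  then have "chain_map \<psi> z - chain_map \<phi> z \<in> boundaries L i"
    unfolding eq boundaries_def by simp
  then have "homology_class L i (chain_map \<psi> z) = homology_class L i (chain_map \<phi> z)"
    by (rule homology_class_eqI)
  then show ?thesis
    using simplicial by (simp add: C homology_map_class[of K])
qed


section \<open>Maps induced in \v{C}ech homology\<close>

text \<open>Same encoding as \<open>Cech_inclusion\<close>, with preimages in place of traces.
  Different members of a cover can have equal preimages, hence the choice by
  \<open>inv_into\<close>.\<close>

definition Cech_map ::
    "('a::topological_space \<Rightarrow> 'b::topological_space) \<Rightarrow> 'a set \<Rightarrow> 'b set \<Rightarrow> int \<Rightarrow>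
      ('a set set \<Rightarrow> ('a set list \<Rightarrow>\<^sub>0 'k::field) set) \<Rightarrow>
      ('b set set \<Rightarrow> ('b set list \<Rightarrow>\<^sub>0 'k) set)" where
  "Cech_map g A B i h =
     (\<lambda>\<U>\<in>open_covers B. homology_map (inv_into \<U> (\<lambda>V. A \<inter> g -` V)) (nerve \<U>) i
        (h ((\<lambda>V. A \<inter> g -` V) ` \<U>)))"

lemma Cech_inclusion_eq_Cech_map: "Cech_inclusion A B i h = Cech_map (\<lambda>x. x) A B i h"
  by (simp add: Cech_inclusion_def Cech_map_def)

lemma preimage_cover:
  assumes "continuous_on A g" "g ` A \<subseteq> B" "\<U> \<in> open_covers B"
  shows "(\<lambda>V. A \<inter> g -` V) ` \<U> \<in> open_covers A"
proof -
  have "openin (top_of_set A) (A \<inter> g -` V)" if "V \<in> \<U>" for V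
    using assms that continuous_openin_preimage[of A g B V] by (auto simp: open_covers_def)
  moreover have "\<Union>\<U> = B"
    using assms(3) by (simp add: open_covers_def)
  ultimately show ?thesis
    using assms(2) by (fastforce simp: open_covers_def)
qed

lemma inv_into_preimage_cover:
  assumes "W \<in> (\<lambda>V. A \<inter> g -` V) ` \<U>"
  shows "inv_into \<U> (\<lambda>V. A \<inter> g -` V) W \<in> \<U>"
    and "A \<inter> g -` inv_into \<U> (\<lambda>V. A \<inter> g -` V) W = W"
  using inv_into_into[OF assms] f_inv_into_f[OF assms] by auto

lemma nerve_faces: "\<sigma> \<in> nerve \<U> \<Longrightarrow> \<rho> \<subseteq> \<sigma> \<Longrightarrow> \<rho> \<noteq> {} \<Longrightarrow> \<rho> \<in> nerve \<U>"
  unfolding nerve_def mem_Collect_eq by (metis Inter_anti_mono finite_subset order_trans subset_empty)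

text \<open>A common point of a simplex is sent by \<open>g\<close> to a common point of its image.
  With the identity for \<open>g\<close> this covers refinement projections.\<close>

lemma nerve_simplicial:
  assumes "\<And>V. V \<in> \<V> \<Longrightarrow> \<pi> V \<in> \<U>" "\<And>V. V \<in> \<V> \<Longrightarrow> g ` V \<subseteq> \<pi> V" "\<sigma> \<in> nerve \<V>"
  shows "\<pi> ` \<sigma> \<in> nerve \<U>"
proof -
  obtain x where "x \<in> \<Inter>\<sigma>" and \<sigma>: "\<sigma> \<subseteq> \<V>" "finite \<sigma>" "\<sigma> \<noteq> {}"
    using assms(3) unfolding nerve_def by blast
  then have "g x \<in> \<Inter>(\<pi> ` \<sigma>)"
    using assms(2) by blast
  then show ?thesis
    using \<sigma> assms(1) by (auto simp: nerve_def)
qed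

lemma Cech_homology_at:
  "h \<in> Cech_homology A i \<Longrightarrow> \<U> \<in> open_covers A \<Longrightarrow> h \<U> \<in> homology (nerve \<U>) i"
  by (auto simp: Cech_homology_def)

lemma Cech_homology_refine:
  assumes "h \<in> Cech_homology A i" "\<U> \<in> open_covers A" "\<V> \<in> open_covers A"
    "\<And>V. V \<in> \<V> \<Longrightarrow> \<pi> V \<in> \<U>" "\<And>V. V \<in> \<V> \<Longrightarrow> V \<subseteq> \<pi> V"
  shows "homology_map \<pi> (nerve \<U>) i (h \<V>) = h \<U>"
  using assms by (auto simp: Cech_homology_def refinement_projection_def)

text \<open>The value of an induced map at a cover can be computed through any cover that is mapped
  into it. Functoriality and homotopy invariance follow by choosing suitable covers.\<close>

lemma Cech_map_at:
  assumes g: "continuous_on A g" "g ` A \<subseteq> B" and h: "h \<in> Cech_homology A i"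
    and \<U>: "\<U> \<in> open_covers B" and \<V>: "\<V> \<in> open_covers A"
    and \<pi>: "\<And>V. V \<in> \<V> \<Longrightarrow> \<pi> V \<in> \<U>" "\<And>V. V \<in> \<V> \<Longrightarrow> g ` V \<subseteq> \<pi> V"
  shows "Cech_map g A B i h \<U> = homology_map \<pi> (nerve \<U>) i (h \<V>)"
proof -
  define p where "p V = A \<inter> g -` V" for V
  define \<phi> where "\<phi> = inv_into \<U> p"
  have cover: "p ` \<U> \<in> open_covers A"
    using preimage_cover[OF g \<U>] by (simp add: p_def)
  have \<phi>: "\<phi> W \<in> \<U>" "p (\<phi> W) = W" if "W \<in> p ` \<U>" for W
    using inv_into_into[OF that] f_inv_into_f[OF that] by (simp_all add: \<phi>_def)
  have sub: "V \<subseteq> p (\<pi> V)" if "V \<in> \<V>" for V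
    using \<pi>(2)[OF that] that \<V> by (auto simp: p_def open_covers_def)
  have im: "p (\<pi> V) \<in> p ` \<U>" if "V \<in> \<V>" for V
    using \<pi>(1)[OF that] by simp
  have "Cech_map g A B i h \<U> = homology_map \<phi> (nerve \<U>) i (h (p ` \<U>))"
    using \<U> by (simp add: Cech_map_def \<phi>_def p_def[abs_def])
  \<comment> \<open>Each \<open>V\<close> lies in the preimage of \<open>\<pi> V\<close>, so
    \<open>p \<circ> \<pi>\<close> is a refinement projection onto the pulled-back cover, with which
    \<open>h\<close> is compatible.\<close>
  also have "h (p ` \<U>) = homology_map (p \<circ> \<pi>) (nerve (p ` \<U>)) i (h \<V>)"
    using im sub by (intro Cech_homology_refine[OF h cover \<V>, symmetric]) auto
  also have "homology_map \<phi> (nerve \<U>) i \<dots> = homology_map (\<phi> \<circ> (p \<circ> \<pi>)) (nerve \<U>) i (h \<V>)"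
  proof (rule homology_map_comp)
    show "(p \<circ> \<pi>) ` \<sigma> \<in> nerve (p ` \<U>)" if "\<sigma> \<in> nerve \<V>" for \<sigma>
      using that im sub by (intro nerve_simplicial[where g = "\<lambda>x. x"]) auto
    show "\<phi> ` \<sigma> \<in> nerve \<U>" if "\<sigma> \<in> nerve (p ` \<U>)" for \<sigma>
      using that
    proof (rule nerve_simplicial[where g = g, rotated 2])
      show "g ` W \<subseteq> \<phi> W" if "W \<in> p ` \<U>" for W
        using \<phi>(2)[OF that] by (auto simp: p_def)
    qed (rule \<phi>)
  qed (rule Cech_homology_at[OF h \<V>])
  \<comment> \<open>The two vertex maps may differ, but \<open>g\<close> sends a common point of a
    simplex into all sets that either of them assigns, so they are contiguous.\<close>
  also have "\<dots> = homology_map \<pi> (nerve \<U>) i (h \<V>)"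
  proof (rule homology_map_contiguous)
    show "(\<phi> \<circ> (p \<circ> \<pi>)) ` \<sigma> \<union> \<pi> ` \<sigma> \<in> nerve \<U>" if \<sigma>\<V>: "\<sigma> \<in> nerve \<V>" for \<sigma>
    proof -
      obtain x where x: "x \<in> \<Inter>\<sigma>" and \<sigma>: "\<sigma> \<subseteq> \<V>" "finite \<sigma>" "\<sigma> \<noteq> {}"
        using \<sigma>\<V> unfolding nerve_def by blast
      have "g x \<in> \<pi> V" "g x \<in> \<phi> (p (\<pi> V))" if "V \<in> \<sigma>" for V
      proof -
        have "V \<in> \<V>" "x \<in> V"
          using x \<sigma> that by auto
        then show "g x \<in> \<pi> V"
          using \<pi>(2) by blast
        have "x \<in> p (\<phi> (p (\<pi> V)))"
          using \<phi>(2)[OF im] sub \<open>V \<in> \<V>\<close> \<open>x \<in> V\<close> by blast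
        then show "g x \<in> \<phi> (p (\<pi> V))"
          by (simp add: p_def)
      qed
      then have "g x \<in> \<Inter>((\<phi> \<circ> (p \<circ> \<pi>)) ` \<sigma> \<union> \<pi> ` \<sigma>)"
        by auto
      moreover have "(\<phi> \<circ> (p \<circ> \<pi>)) ` \<sigma> \<union> \<pi> ` \<sigma> \<subseteq> \<U>"
        using \<sigma> \<pi>(1) \<phi>(1)[OF im] by auto
      ultimately show ?thesis
        using \<sigma> unfolding nerve_def by blast
    qed
    show "{} \<notin> nerve \<V>"
      by (simp add: nerve_def)
  qed (auto intro: nerve_faces Cech_homology_at[OF h \<V>])
  finally show ?thesis .
qed

text \<open>Hides \<open>inv_into\<close> behind the two properties that the nerve arguments use.
  The choice depends on the cover alone, so one \<open>\<phi>\<close> serves every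
  \<open>h\<close>.\<close>

lemma Cech_map_choice:
  assumes "continuous_on A g" "g ` A \<subseteq> B" "\<U> \<in> open_covers B"
  obtains \<phi> where "\<And>W. W \<in> (\<lambda>V. A \<inter> g -` V) ` \<U> \<Longrightarrow> \<phi> W \<in> \<U>"
    "\<And>W. W \<in> (\<lambda>V. A \<inter> g -` V) ` \<U> \<Longrightarrow> g ` W \<subseteq> \<phi> W"
    "\<And>h. Cech_map g A B i h \<U> = homology_map \<phi> (nerve \<U>) i (h ((\<lambda>V. A \<inter> g -` V) ` \<U>))"
proof
  let ?\<phi> = "inv_into \<U> (\<lambda>V. A \<inter> g -` V)"
  show "g ` W \<subseteq> ?\<phi> W" if "W \<in> (\<lambda>V. A \<inter> g -` V) ` \<U>" for W
    using inv_into_preimage_cover(2)[OF that] by blast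
  show "Cech_map g A B i h \<U> = homology_map ?\<phi> (nerve \<U>) i (h ((\<lambda>V. A \<inter> g -` V) ` \<U>))" for h
    using assms(3) by (simp add: Cech_map_def)
qed (rule inv_into_preimage_cover)

text \<open>Compatibility with a projection from \<open>\<V>\<close> to \<open>\<U>\<close> holds
  because the value at \<open>\<U>\<close> can be computed through the preimages of
  \<open>\<V>\<close>, by \<open>Cech_map_at\<close>.\<close>

lemma Cech_map_in_Cech_homology:
  assumes g: "continuous_on A g" "g ` A \<subseteq> B" and h: "h \<in> Cech_homology A i"
  shows "Cech_map g A B i h \<in> Cech_homology B i"
  unfolding Cech_homology_def
proof (intro CollectI conjI ballI allI impI PiE_I)
  fix \<U> assume \<U>: "\<U> \<in> open_covers B"
  let ?p = "\<lambda>V. A \<inter> g -` V"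
  obtain \<phi> where \<phi>: "\<And>W. W \<in> ?p ` \<U> \<Longrightarrow> \<phi> W \<in> \<U>" "\<And>W. W \<in> ?p ` \<U> \<Longrightarrow> g ` W \<subseteq> \<phi> W"
    "Cech_map g A B i h \<U> = homology_map \<phi> (nerve \<U>) i (h (?p ` \<U>))"
    using Cech_map_choice[OF g \<U>] by metis
  show "Cech_map g A B i h \<U> \<in> homology (nerve \<U>) i"
    unfolding \<phi>(3)
  proof (rule homology_map_in_homology)
    show "\<phi> ` \<sigma> \<in> nerve \<U>" if "\<sigma> \<in> nerve (?p ` \<U>)" for \<sigma>
      by (rule nerve_simplicial[OF \<phi>(1,2) that])
  qed (rule Cech_homology_at[OF h preimage_cover[OF g \<U>]])
next
  fix \<U> \<V> \<pi>
  assume \<U>: "\<U> \<in> open_covers B" and \<V>: "\<V> \<in> open_covers B"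
    and \<pi>: "refinement_projection \<V> \<U> \<pi>"
  let ?p = "\<lambda>V. A \<inter> g -` V"
  have cover: "?p ` \<V> \<in> open_covers A"
    by (rule preimage_cover[OF g \<V>])
  obtain \<phi> where \<phi>: "\<And>W. W \<in> ?p ` \<V> \<Longrightarrow> \<phi> W \<in> \<V>" "\<And>W. W \<in> ?p ` \<V> \<Longrightarrow> g ` W \<subseteq> \<phi> W"
    "Cech_map g A B i h \<V> = homology_map \<phi> (nerve \<V>) i (h (?p ` \<V>))"
    using Cech_map_choice[OF g \<V>] by metis
  have "homology_map \<pi> (nerve \<U>) i (Cech_map g A B i h \<V>) =
      homology_map (\<pi> \<circ> \<phi>) (nerve \<U>) i (h (?p ` \<V>))"
    unfolding \<phi>(3)
  proof (rule homology_map_comp)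
    show "\<phi> ` \<sigma> \<in> nerve \<V>" if "\<sigma> \<in> nerve (?p ` \<V>)" for \<sigma>
      by (rule nerve_simplicial[OF \<phi>(1,2) that])
    show "\<pi> ` \<sigma> \<in> nerve \<U>" if "\<sigma> \<in> nerve \<V>" for \<sigma>
      using \<pi> that by (intro nerve_simplicial[of \<V> \<pi> \<U> "\<lambda>x. x"]) (auto simp: refinement_projection_def)
  qed (rule Cech_homology_at[OF h cover])
  also have "\<dots> = Cech_map g A B i h \<U>"
  proof (rule Cech_map_at[OF g h \<U> cover, symmetric])
    fix W assume W: "W \<in> ?p ` \<V>"
    have "\<phi> W \<in> \<V>"
      by (rule \<phi>(1)[OF W])
    then have *: "\<pi> (\<phi> W) \<in> \<U>" "\<phi> W \<subseteq> \<pi> (\<phi> W)"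
      using \<pi> by (simp_all add: refinement_projection_def)
    show "(\<pi> \<circ> \<phi>) W \<in> \<U>"
      using * by simp
    show "g ` W \<subseteq> (\<pi> \<circ> \<phi>) W"
      using *(2) \<phi>(2)[OF W] by simp
  qed
  finally show "homology_map \<pi> (nerve \<U>) i (Cech_map g A B i h \<V>) = Cech_map g A B i h \<U>" .
qed (simp add: Cech_map_def)

lemma Cech_map_Cech_map:
  fixes h :: "'a::topological_space set set \<Rightarrow> ('a set list \<Rightarrow>\<^sub>0 'k::field) set"
    and B :: "'b::topological_space set"
  assumes g: "continuous_on A g" "g ` A \<subseteq> B" and k: "continuous_on B k" "k ` B \<subseteq> C"
    and h: "h \<in> Cech_homology A i"
  shows "Cech_map k B C i (Cech_map g A B i h) = Cech_map (\<lambda>x. k (g x)) A C i h"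
proof
  fix \<U>
  show "Cech_map k B C i (Cech_map g A B i h) \<U> = Cech_map (\<lambda>x. k (g x)) A C i h \<U>"
  proof (cases "\<U> \<in> open_covers C")
    case \<U>: True
    have kg: "continuous_on A (\<lambda>x. k (g x))" "(\<lambda>x. k (g x)) ` A \<subseteq> C"
      using g k by (auto intro: continuous_on_compose2)
    let ?p = "\<lambda>V. B \<inter> k -` V" and ?q = "\<lambda>V. A \<inter> g -` V"
    have covB: "?p ` \<U> \<in> open_covers B"
      by (rule preimage_cover[OF k \<U>])
    have covA: "?q ` ?p ` \<U> \<in> open_covers A"
      by (rule preimage_cover[OF g covB])
    obtain \<phi> where \<phi>: "\<And>W. W \<in> ?p ` \<U> \<Longrightarrow> \<phi> W \<in> \<U>" "\<And>W. W \<in> ?p ` \<U> \<Longrightarrow> k ` W \<subseteq> \<phi> W"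
      "\<And>h :: 'b set set \<Rightarrow> ('b set list \<Rightarrow>\<^sub>0 'k) set. Cech_map k B C i h \<U> =
         homology_map \<phi> (nerve \<U>) i (h (?p ` \<U>))"
      using Cech_map_choice[OF k \<U>] by metis
    obtain \<psi> where \<psi>: "\<And>W. W \<in> ?q ` ?p ` \<U> \<Longrightarrow> \<psi> W \<in> ?p ` \<U>" "\<And>W. W \<in> ?q ` ?p ` \<U> \<Longrightarrow> g ` W \<subseteq> \<psi> W"
      "Cech_map g A B i h (?p ` \<U>) = homology_map \<psi> (nerve (?p ` \<U>)) i (h (?q ` ?p ` \<U>))"
      using Cech_map_choice[OF g covB] by metis
    have "Cech_map k B C i (Cech_map g A B i h) \<U> =
        homology_map (\<phi> \<circ> \<psi>) (nerve \<U>) i (h (?q ` ?p ` \<U>))"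
      unfolding \<phi>(3) \<psi>(3)
    proof (rule homology_map_comp)
      show "\<psi> ` \<sigma> \<in> nerve (?p ` \<U>)" if "\<sigma> \<in> nerve (?q ` ?p ` \<U>)" for \<sigma>
        by (rule nerve_simplicial[OF \<psi>(1,2) that])
      show "\<phi> ` \<sigma> \<in> nerve \<U>" if "\<sigma> \<in> nerve (?p ` \<U>)" for \<sigma>
        by (rule nerve_simplicial[OF \<phi>(1,2) that])
    qed (rule Cech_homology_at[OF h covA])
    \<comment> \<open>The composite maps the twice pulled-back cover into \<open>\<U>\<close>, so
      its value can be read off there too.\<close>
    also have "\<dots> = Cech_map (\<lambda>x. k (g x)) A C i h \<U>"
    proof (rule Cech_map_at[OF kg h \<U> covA, symmetric])
      fix W assume W: "W \<in> ?q ` ?p ` \<U>"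
      show "(\<phi> \<circ> \<psi>) W \<in> \<U>"
        using \<phi>(1)[OF \<psi>(1)[OF W]] by simp
      show "(\<lambda>x. k (g x)) ` W \<subseteq> (\<phi> \<circ> \<psi>) W"
        using \<phi>(2)[OF \<psi>(1)[OF W]] \<psi>(2)[OF W] by auto
    qed
    finally show ?thesis .
  \<comment> \<open>Off the covers of \<open>C\<close> both sides are
    \<open>undefined\<close>.\<close>
  qed (simp add: Cech_map_def)
qed

lemma Cech_map_cong:
  assumes "\<And>x. x \<in> A \<Longrightarrow> g x = g' x"
  shows "Cech_map g A B i h = Cech_map g' A B i h"
proof -
  have "(\<lambda>V. A \<inter> g -` V) = (\<lambda>V. A \<inter> g' -` V)"
    using assms by auto
  then show ?thesis
    unfolding Cech_map_def by presburger
qed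

text \<open>If two slices send every member of a cover into a common member of \<open>\<U>\<close>,
  one vertex map computes both values at \<open>\<U>\<close>. A Lebesgue number achieves this for
  adjacent times of a fine subdivision.\<close>

lemma Cech_map_homotopic:
  fixes H :: "real \<times> 'a::heine_borel \<Rightarrow> 'b::topological_space"
  assumes A: "compact A" and H: "continuous_on ({0..1} \<times> A) H" "H ` ({0..1} \<times> A) \<subseteq> B"
    and h: "h \<in> Cech_homology A i"
  shows "Cech_map (\<lambda>x. H (0, x)) A B i h = Cech_map (\<lambda>x. H (1, x)) A B i h"
proof
  fix \<U>
  show "Cech_map (\<lambda>x. H (0, x)) A B i h \<U> = Cech_map (\<lambda>x. H (1, x)) A B i h \<U>"
  proof (cases "\<U> \<in> open_covers B")
    case \<U>: True
    let ?I = "{0..1::real} \<times> A"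
    \<comment> \<open>The relatively open preimages are replaced by open sets of the ambient space,
      as the Lebesgue number lemma expects.\<close>
    define \<G> where "\<G> = {G. open G \<and> (\<exists>V\<in>\<U>. ?I \<inter> G \<subseteq> H -` V)}"
    have "?I \<subseteq> \<Union>\<G>"
    proof
      fix z assume z: "z \<in> ?I"
      then have "H z \<in> \<Union>\<U>"
        using H(2) \<U> by (auto simp: open_covers_def)
      then obtain V where V: "V \<in> \<U>" "H z \<in> V"
        by blast
      then have "openin (top_of_set ?I) (?I \<inter> H -` V)"
        using H \<U> by (intro continuous_openin_preimage[of _ _ B]) (auto simp: open_covers_def)
      then obtain G where "open G" "?I \<inter> H -` V = ?I \<inter> G"
        by (auto simp: openin_open)
      then show "z \<in> \<Union>\<G>"
        using V z unfolding \<G>_def by blast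
    qed
    moreover have "compact ?I"
      using A by (simp add: compact_Times)
    ultimately obtain e where e: "e > 0" "\<And>z. z \<in> ?I \<Longrightarrow> \<exists>G\<in>\<G>. ball z e \<subseteq> G"
      using Heine_Borel_lemma[of ?I \<G>] unfolding \<G>_def by blast
    \<comment> \<open>Time steps and balls in \<open>A\<close> both have size below or equal to
      \<open>e / 4\<close>, so a point of a ball, taken at either of two adjacent times, is within
      \<open>e\<close> of the center at the first.\<close>
    obtain N where N: "0 < N" "inverse (real N) < e / 4"
      using e(1) reals_Archimedean[of "e / 4"] by (metis divide_pos_pos of_nat_0_less_iff zero_less_Suc zero_less_numeral)
    define \<V> where "\<V> = (\<lambda>x. A \<inter> ball x (e / 4)) ` A"
    have \<V>: "\<V> \<in> open_covers A"
      using e(1) by (auto simp: open_covers_def \<V>_def openin_open_Int)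
    have slice: "continuous_on A (\<lambda>x. H (t, x))" "(\<lambda>x. H (t, x)) ` A \<subseteq> B" if "t \<in> {0..1}" for t
    proof -
      show "continuous_on A (\<lambda>x. H (t, x))"
        using that by (intro continuous_on_compose2[OF H(1)] continuous_intros) auto
      show "(\<lambda>x. H (t, x)) ` A \<subseteq> B"
        using that H(2) by blast
    qed
    define C where "C k = Cech_map (\<lambda>x. H (real k / real N, x)) A B i h \<U>" for k
    have "C k = C (Suc k)" if "k < N" for k
    proof -
      let ?t = "real k / real N" and ?t' = "real (Suc k) / real N"
      have t: "?t \<in> {0..1}" "?t' \<in> {0..1}" "\<bar>?t' - ?t\<bar> < e / 4"
        using that N by (auto simp: field_simps inverse_eq_divide)
      have "\<exists>V\<in>\<U>. (\<lambda>x. H (?t, x)) ` W \<subseteq> V \<and> (\<lambda>x. H (?t', x)) ` W \<subseteq> V" if "W \<in> \<V>" for W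
      proof -
        obtain x where x: "x \<in> A" "W = A \<inter> ball x (e / 4)"
          using \<open>W \<in> \<V>\<close> by (auto simp: \<V>_def)
        obtain G where "G \<in> \<G>" and G: "ball (?t, x) e \<subseteq> G"
          using e(2)[of "(?t, x)"] x t by auto
        then obtain V where V: "V \<in> \<U>" "?I \<inter> G \<subseteq> H -` V"
          by (auto simp: \<G>_def)
        have "H (r, y) \<in> V" if "y \<in> W" "r = ?t \<or> r = ?t'" for r y
        proof -
          have "dist (?t, x) (r, y) \<le> dist ?t r + dist x y"
            unfolding dist_Pair_Pair by (rule sqrt_sum_squares_le_sum) auto
          also have "\<dots> < e / 4 + e / 4"
            using that x t e(1) by (intro add_less_le_mono) (auto simp: dist_real_def abs_minus_commute)
          finally have "(r, y) \<in> ball (?t, x) e"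
            using e(1) by simp
          then show ?thesis
            using V(2) G that x t by blast
        qed
        then show ?thesis
          using V(1) by blast
      qed
      then obtain \<pi> where \<pi>: "\<And>W. W \<in> \<V> \<Longrightarrow> \<pi> W \<in> \<U>"
        "\<And>W. W \<in> \<V> \<Longrightarrow> (\<lambda>x. H (?t, x)) ` W \<subseteq> \<pi> W"
        "\<And>W. W \<in> \<V> \<Longrightarrow> (\<lambda>x. H (?t', x)) ` W \<subseteq> \<pi> W"
        by metis
      show ?thesis
        unfolding C_def
        using Cech_map_at[OF slice[OF t(1)] h \<U> \<V> \<pi>(1,2)]
          Cech_map_at[OF slice[OF t(2)] h \<U> \<V> \<pi>(1,3)] by simp
    qed
    then have "C 0 = C k" if "k \<le> N" for k
      using that by (induction k) auto
    then have "C 0 = C N"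
      by simp
    then show ?thesis
      using N(1) by (simp add: C_def)
  qed (simp add: Cech_map_def)
qed


section \<open>Ranks\<close>

text \<open>Linear combinations are indexed by the classes themselves, so linearity is stated along
  an injective choice \<open>s\<close> of preimages, which allows reindexing.\<close>

lemma Cech_map_lincomb:
  fixes s :: "('b::topological_space set set \<Rightarrow> ('b set list \<Rightarrow>\<^sub>0 'k::field) set) \<Rightarrow>
      ('a::topological_space set set \<Rightarrow> ('a set list \<Rightarrow>\<^sub>0 'k) set)"
  assumes g: "continuous_on A g" "g ` A \<subseteq> B"
    and s: "\<And>h. h \<in> H \<Longrightarrow> s h \<in> Cech_homology A i"
      "\<And>h. h \<in> H \<Longrightarrow> Cech_map g A B i (s h) = h" "inj_on s H"
  shows "Cech_map g A B i (Cech_lincomb A i (s ` H) a) = Cech_lincomb B i H (a \<circ> s)"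
proof
  fix \<U>
  show "Cech_map g A B i (Cech_lincomb A i (s ` H) a) \<U> = Cech_lincomb B i H (a \<circ> s) \<U>"
  proof (cases "\<U> \<in> open_covers B")
    case \<U>: True
    let ?p = "\<lambda>V. A \<inter> g -` V"
    obtain \<phi> where \<phi>: "\<And>W. W \<in> ?p ` \<U> \<Longrightarrow> \<phi> W \<in> \<U>" "\<And>W. W \<in> ?p ` \<U> \<Longrightarrow> g ` W \<subseteq> \<phi> W"
      "\<And>h :: 'a set set \<Rightarrow> ('a set list \<Rightarrow>\<^sub>0 'k) set. Cech_map g A B i h \<U> =
        homology_map \<phi> (nerve \<U>) i (h (?p ` \<U>))"
      using Cech_map_choice[OF g \<U>] by metis
    have cover: "?p ` \<U> \<in> open_covers A"
      by (rule preimage_cover[OF g \<U>])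
    have "\<exists>z. h (?p ` \<U>) = homology_class (nerve (?p ` \<U>)) i z" if "h \<in> s ` H" for h
      using that s(1) Cech_homology_at[OF _ cover] by (fastforce simp: homology_def)
    then obtain z where z: "\<And>h. h \<in> s ` H \<Longrightarrow> h (?p ` \<U>) = homology_class (nerve (?p ` \<U>)) i (z h)"
      by metis
    have push: "homology_map \<phi> (nerve \<U>) i (homology_class (nerve (?p ` \<U>)) i w) =
        homology_class (nerve \<U>) i (chain_map \<phi> w)"
      for w :: "'a set list \<Rightarrow>\<^sub>0 'k"
      by (rule homology_map_class) (rule nerve_simplicial[OF \<phi>(1,2)])
    have "Cech_map g A B i (Cech_lincomb A i (s ` H) a) \<U> =
        homology_class (nerve \<U>) i (chain_map \<phi> (\<Sum>h\<in>s ` H. chain_scale (a h) (z h)))"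
    proof -
      have "class_lincomb (nerve (?p ` \<U>)) i (s ` H) a (\<lambda>h. h (?p ` \<U>)) =
          homology_class (nerve (?p ` \<U>)) i (\<Sum>h\<in>s ` H. chain_scale (a h) (z h))"
        by (rule class_lincomb_class) (rule z)
      then show ?thesis
        using cover by (simp add: \<phi>(3) Cech_lincomb_def push)
    qed
    also have "chain_map \<phi> (\<Sum>h\<in>s ` H. chain_scale (a h) (z h)) =
        (\<Sum>h\<in>H. chain_scale ((a \<circ> s) h) (chain_map \<phi> (z (s h))))"
      using s(3) by (simp add: chain_extend_sum chain_extend_scale sum.reindex)
    also have "homology_class (nerve \<U>) i \<dots> = Cech_lincomb B i H (a \<circ> s) \<U>"
    proof -
      have "h \<U> = homology_class (nerve \<U>) i (chain_map \<phi> (z (s h)))" if "h \<in> H" for h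
        using s(2)[OF that] \<phi>(3)[of "s h"] z[of "s h"] that by (simp add: push)
      then have "class_lincomb (nerve \<U>) i H (a \<circ> s) (\<lambda>h. h \<U>) =
          homology_class (nerve \<U>) i (\<Sum>h\<in>H. chain_scale ((a \<circ> s) h) (chain_map \<phi> (z (s h))))"
        by (rule class_lincomb_class)
      then show ?thesis
        using \<U> by (simp add: Cech_lincomb_def)
    qed
    finally show ?thesis .
  qed (simp add: Cech_map_def Cech_lincomb_def)
qed

text \<open>Zero is the linear combination of the empty family.\<close>

lemma Cech_map_zero:
  assumes g: "continuous_on A g" "g ` A \<subseteq> B"
  shows "Cech_map g A B i (Cech_zero A i) = Cech_zero B i"
  using Cech_map_lincomb[OF g, of "{}"] by (simp add: Cech_lincomb_def Cech_zero_def class_lincomb_def)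

text \<open>An independent family in \<open>T\<close> lifts to \<open>S\<close> through a right
  inverse of the induced map; a relation among the lifts is mapped to one among the original
  classes.\<close>

lemma Cech_dim_image_le:
  assumes g: "continuous_on A g" "g ` A \<subseteq> B"
    and S: "S \<subseteq> Cech_homology A i" and T: "T \<subseteq> Cech_map g A B i ` S"
  shows "Cech_dim B i T \<le> Cech_dim A i (S :: (_ \<Rightarrow> (_ \<Rightarrow>\<^sub>0 'k::field) set) set)"
  unfolding Cech_dim_def
proof (rule SUP_least)
  fix H assume "H \<in> {H. H \<subseteq> T \<and> Cech_independent B i H}"
  then have H: "H \<subseteq> T" "Cech_independent B i H"
    by auto
  define s where "s = inv_into S (Cech_map g A B i)"
  have s: "s h \<in> S" "Cech_map g A B i (s h) = h" if "h \<in> H" for h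
  proof -
    have "h \<in> Cech_map g A B i ` S"
      using that H T by blast
    then show "s h \<in> S" "Cech_map g A B i (s h) = h"
      unfolding s_def by (rule inv_into_into, rule f_inv_into_f)
  qed
  have inj: "inj_on s H"
    by (metis s(2) inj_onI)
  have "\<forall>h\<in>s ` H. a h = 0" if a: "Cech_lincomb A i (s ` H) a = Cech_zero A i" for a
  proof -
    have "Cech_map g A B i (Cech_lincomb A i (s ` H) a) = Cech_lincomb B i H (a \<circ> s)"
      using s S inj by (intro Cech_map_lincomb[OF g]) auto
    then have "Cech_lincomb B i H (a \<circ> s) = Cech_zero B i"
      by (simp add: a Cech_map_zero[OF g])
    then show ?thesis
      using H(2) by (auto simp: Cech_independent_def)
  qed
  then have "Cech_independent A i (s ` H)" "s ` H \<subseteq> S"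
    using H(2) s(1) by (auto simp: Cech_independent_def)
  moreover have "card (s ` H) = card H"
    by (rule card_image[OF inj])
  ultimately show "enat (card H) \<le> (SUP H\<in>{H. H \<subseteq> S \<and> Cech_independent A i H}. enat (card H))"
    by (intro SUP_upper2[of "s ` H"]) auto
qed

text \<open>If the inclusion \<open>A' \<subseteq> B'\<close> factors up to homotopy through \<open>A \<subseteq> B\<close>, then so does the
  homomorphism that it induces, whence the inequality of ranks.\<close>

lemma Cech_inclusion_rank_le:
  fixes A' B' :: "'a::heine_borel set" and A B :: "'b::topological_space set"
  assumes A': "compact A'" and AB: "A \<subseteq> B"
    and g: "continuous_on A' g" "g ` A' \<subseteq> A" and k: "continuous_on B k" "k ` B \<subseteq> B'"
    and H: "continuous_on ({0..1} \<times> A') H" "H ` ({0..1} \<times> A') \<subseteq> B'"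
    and H01: "\<And>x. x \<in> A' \<Longrightarrow> H (0::real, x) = x" "\<And>x. x \<in> A' \<Longrightarrow> H (1, x) = k (g x)"
  shows "Cech_dim B' i (Cech_inclusion A' B' i ` (Cech_homology A' i :: (_ \<Rightarrow> (_ \<Rightarrow>\<^sub>0 'k::field) set) set))
    \<le> Cech_dim B i (Cech_inclusion A B i ` (Cech_homology A i :: (_ \<Rightarrow> (_ \<Rightarrow>\<^sub>0 'k) set) set))"
proof (rule Cech_dim_image_le[OF k])
  have id: "continuous_on A (\<lambda>x. x)" "(\<lambda>x. x) ` A \<subseteq> B"
    using AB by auto
  show "Cech_inclusion A B i ` Cech_homology A i \<subseteq> (Cech_homology B i :: (_ \<Rightarrow> (_ \<Rightarrow>\<^sub>0 'k) set) set)"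
    using Cech_map_in_Cech_homology[OF id] by (auto simp: Cech_inclusion_eq_Cech_map)
  show "Cech_inclusion A' B' i ` Cech_homology A' i \<subseteq>
      Cech_map k B B' i ` Cech_inclusion A B i ` (Cech_homology A i :: (_ \<Rightarrow> (_ \<Rightarrow>\<^sub>0 'k) set) set)"
  proof
    fix c :: "'a set set \<Rightarrow> ('a set list \<Rightarrow>\<^sub>0 'k) set"
    assume "c \<in> Cech_inclusion A' B' i ` Cech_homology A' i"
    then obtain h where h: "h \<in> Cech_homology A' i" and c: "c = Cech_map (\<lambda>x. x) A' B' i h"
      by (auto simp: Cech_inclusion_eq_Cech_map)
    have "c = Cech_map (\<lambda>x. H (0, x)) A' B' i h"
      unfolding c by (rule Cech_map_cong) (simp add: H01)
    also have "\<dots> = Cech_map (\<lambda>x. H (1, x)) A' B' i h"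
      by (rule Cech_map_homotopic[OF A' H h])
    also have "\<dots> = Cech_map (\<lambda>x. k (g x)) A' B' i h"
      by (rule Cech_map_cong) (simp add: H01)
    also have "\<dots> = Cech_map k B B' i (Cech_map g A' B i h)"
      using g AB by (intro Cech_map_Cech_map[OF _ _ k h, symmetric]) auto
    \<comment> \<open>Splitting \<open>g\<close> as a map into \<open>A\<close> followed by the
      inclusion exhibits the class as coming from the image of
      \<open>A \<subseteq> B\<close>.\<close>
    also have "Cech_map g A' B i h = Cech_map (\<lambda>x. x) A B i (Cech_map g A' A i h)"
      using Cech_map_Cech_map[OF g id h] by simp
    finally show "c \<in> Cech_map k B B' i ` Cech_inclusion A B i ` Cech_homology A i"
      using Cech_map_in_Cech_homology[OF g h] by (auto simp: Cech_inclusion_eq_Cech_map)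
  qed
qed


section \<open>Betti numbers of a retract\<close>

lemma compact_sublevel:
  fixes f :: "'a::t2_space \<Rightarrow> real ^ 'n"
  assumes "compact Z" "continuous_on Z f"
  shows "compact (sublevel Z f u)"
proof -
  have "sublevel Z f u = (\<Inter>j. {p \<in> Z. f p $ j \<le> u $ j})"
    by (auto simp: sublevel_def)
  moreover have "closedin (top_of_set Z) {p \<in> Z. f p $ j \<le> u $ j}" for j
    using assms(2)
    by (intro continuous_closedin_preimage[of Z "\<lambda>p. f p $ j" "{..u $ j}", unfolded vimage_def Int_def, simplified])
       (auto intro: continuous_intros)
  ultimately have "closedin (top_of_set Z) (sublevel Z f u)"
    by (auto intro: closedin_INT)
  then show ?thesis
    using assms(1) closedin_compact by blast
qed

text \<open>An interleaving of the two filtrations. The variation of \<open>f\<close> is bounded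
  along whole segments, and not only at their ends, because the straight-line homotopy to the
  retraction must stay in a sublevel set.\<close>

lemma persistent_betti_retract:
  fixes X U :: "'a::euclidean_space set" and f :: "'a \<Rightarrow> real ^ 'n"
  assumes "compact X" "compact U" "X \<subseteq> U" "continuous_on U f"
    and \<rho>: "continuous_on U \<rho>" "\<rho> ` U \<subseteq> X" "\<And>p. p \<in> X \<Longrightarrow> \<rho> p = p"
    and segment: "\<And>q t. q \<in> U \<Longrightarrow> 0 \<le> t \<Longrightarrow> t \<le> 1 \<Longrightarrow> (1 - t) *\<^sub>R q + t *\<^sub>R \<rho> q \<in> U"
    and variation: "\<And>q t j. q \<in> U \<Longrightarrow> 0 \<le> t \<Longrightarrow> t \<le> 1 \<Longrightarrow>
      \<bar>f q $ j - f ((1 - t) *\<^sub>R q + t *\<^sub>R \<rho> q) $ j\<bar> \<le> \<omega> $ j"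
  shows "\<forall>j. u $ j \<le> v $ j \<Longrightarrow> persistent_betti TYPE('k::field) U f i (u - \<omega>, v + \<omega>)
      \<le> persistent_betti TYPE('k) X f i (u, v)"
    and "\<forall>j. (u + \<omega>) $ j \<le> (v - \<omega>) $ j \<Longrightarrow> persistent_betti TYPE('k::field) X f i (u, v)
      \<le> persistent_betti TYPE('k) U f i (u + \<omega>, v - \<omega>)"
proof -
  define H where "H z = (1 - fst z) *\<^sub>R snd z + fst z *\<^sub>R \<rho> (snd z)" for z
  have \<omega>: "0 \<le> \<omega> $ j" if "q \<in> U" for q j
    using variation[OF that, of 0 j] by simp
  have \<rho>_var: "\<bar>f q $ j - f (\<rho> q) $ j\<bar> \<le> \<omega> $ j" if "q \<in> U" for q j
    using variation[OF that, of 1 j] by simp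
  have contX: "continuous_on X f"
    using assms by (blast intro: continuous_on_subset)
  show "persistent_betti TYPE('k) U f i (u - \<omega>, v + \<omega>) \<le> persistent_betti TYPE('k) X f i (u, v)"
    if uv: "\<forall>j. u $ j \<le> v $ j"
    unfolding persistent_betti_def prod.case
  \<comment> \<open>Retract to \<open>X\<close> at level \<open>u\<close>, include at level
    \<open>v\<close>, and go back to \<open>U\<close>; the segments join this composite to the
    inclusion.\<close>
  proof (rule Cech_inclusion_rank_le[where g = \<rho> and k = "\<lambda>p. p" and H = H])
    have sub: "sublevel U f (u - \<omega>) \<subseteq> U"
      by (auto simp: sublevel_def)
    show "compact (sublevel U f (u - \<omega>))"
      using assms by (intro compact_sublevel) auto
    show "sublevel X f u \<subseteq> sublevel X f v"
      using uv by (auto simp: sublevel_def intro: order_trans)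
    show "continuous_on (sublevel U f (u - \<omega>)) \<rho>"
      using \<rho>(1) sub by (rule continuous_on_subset)
    show "\<rho> ` sublevel U f (u - \<omega>) \<subseteq> sublevel X f u"
    proof -
      have "f (\<rho> q) $ j \<le> u $ j" if "q \<in> U" "f q $ j \<le> u $ j - \<omega> $ j" for q j
        using \<rho>_var[OF that(1), of j] that(2) by linarith
      then show ?thesis
        using \<rho>(2) by (auto simp: sublevel_def)
    qed
    show "(\<lambda>p. p) ` sublevel X f v \<subseteq> sublevel U f (v + \<omega>)"
    proof -
      have "f p $ j \<le> v $ j + \<omega> $ j" if "p \<in> X" "f p $ j \<le> v $ j" for p j
        using \<omega>[of p j] that assms(3) by force
      then show ?thesis
        using assms(3) by (auto simp: sublevel_def)
    qed
    show "continuous_on ({0..1} \<times> sublevel U f (u - \<omega>)) H"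
      unfolding H_def using sub
      by (intro continuous_intros continuous_on_compose2[OF \<rho>(1)]) auto
    show "H ` ({0..1} \<times> sublevel U f (u - \<omega>)) \<subseteq> sublevel U f (v + \<omega>)"
    proof -
      have "f (H (t, q)) $ j \<le> v $ j + \<omega> $ j"
        if "q \<in> U" "0 \<le> t" "t \<le> 1" "f q $ j \<le> u $ j - \<omega> $ j" for q t j
        using variation[OF that(1-3), of j] that(4) uv[rule_format, of j] \<omega>[OF that(1), of j]
        unfolding H_def fst_conv snd_conv by linarith
      then show ?thesis
        using segment by (auto simp: sublevel_def H_def)
    qed
  qed (auto simp: H_def)
  show "persistent_betti TYPE('k) X f i (u, v) \<le> persistent_betti TYPE('k) U f i (u + \<omega>, v - \<omega>)"
    if uv: "\<forall>j. (u + \<omega>) $ j \<le> (v - \<omega>) $ j"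
    unfolding persistent_betti_def prod.case
  \<comment> \<open>Include into \<open>U\<close> and retract at the end. As \<open>\<rho>\<close>
    fixes \<open>X\<close>, the composite is the inclusion itself, and the constant homotopy
    \<open>snd\<close> suffices.\<close>
  proof (rule Cech_inclusion_rank_le[where g = "\<lambda>p. p" and k = \<rho> and H = snd])
    have sub: "sublevel U f (v - \<omega>) \<subseteq> U"
      by (auto simp: sublevel_def)
    show "compact (sublevel X f u)"
      using assms(1) contX by (rule compact_sublevel)
    show "sublevel U f (u + \<omega>) \<subseteq> sublevel U f (v - \<omega>)"
      using uv by (auto simp: sublevel_def intro: order_trans)
    show "continuous_on (sublevel U f (v - \<omega>)) \<rho>"
      using \<rho>(1) sub by (rule continuous_on_subset)
    show "(\<lambda>p. p) ` sublevel X f u \<subseteq> sublevel U f (u + \<omega>)"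
    proof -
      have "f p $ j \<le> u $ j + \<omega> $ j" if "p \<in> X" "f p $ j \<le> u $ j" for p j
        using \<omega>[of p j] that assms(3) by force
      then show ?thesis
        using assms(3) by (auto simp: sublevel_def)
    qed
    show "\<rho> ` sublevel U f (v - \<omega>) \<subseteq> sublevel X f v"
    proof -
      have "f (\<rho> q) $ j \<le> v $ j" if "q \<in> U" "f q $ j \<le> v $ j - \<omega> $ j" for q j
        using \<rho>_var[OF that(1), of j] that(2) by linarith
      then show ?thesis
        using \<rho>(2) by (auto simp: sublevel_def)
    qed
    show "snd ` ({0..1} \<times> sublevel X f u) \<subseteq> sublevel X f v"
    proof -
      have "f p $ j \<le> v $ j" if "p \<in> X" "f p $ j \<le> u $ j" for p j
        using \<omega>[of p j] that assms(3) uv[rule_format, of j] by force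
      then show ?thesis
        by (auto simp: sublevel_def)
    qed
    show "continuous_on ({0..1} \<times> sublevel X f u) snd"
      by (intro continuous_intros)
  qed (auto simp: sublevel_def \<rho>(3))
qed


section \<open>The nearest-point retraction\<close>

text \<open>Along a curve in \<open>X\<close> through \<open>p\<close>, the squared distance from
  \<open>q\<close> has a local minimum at \<open>p\<close>, so its derivative there
  vanishes.\<close>

lemma nearest_point_normal:
  fixes X :: "'a::euclidean_space set"
  assumes "p \<in> X" and nearest: "\<And>x. x \<in> X \<Longrightarrow> dist q p \<le> dist q x" and v: "v \<in> tangent_space X p"
  shows "orthogonal (q - p) v"
proof -
  obtain \<gamma> e where \<gamma>: "e > 0" "\<gamma> ` {-e<..<e} \<subseteq> X" "\<gamma> 0 = p" "(\<gamma> has_vector_derivative v) (at 0)"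
    using v by (auto simp: tangent_space_def)
  define \<phi> where "\<phi> t = (\<gamma> t - q) \<bullet> (\<gamma> t - q)" for t
  have "((\<lambda>t. \<gamma> t - q) has_derivative (\<lambda>h. h *\<^sub>R v)) (at 0)"
    using \<gamma>(4) by (auto simp: has_vector_derivative_def intro!: derivative_eq_intros)
  from has_derivative_inner[OF this this]
  have "(\<phi> has_derivative (\<lambda>h. 2 * ((p - q) \<bullet> v) * h)) (at 0)"
    unfolding \<phi>_def by (simp add: \<gamma>(3) inner_commute algebra_simps)
  then have "DERIV \<phi> 0 :> 2 * ((p - q) \<bullet> v)"
    by (simp add: has_field_derivative_def)
  moreover have "\<phi> 0 \<le> \<phi> t" if "\<bar>0 - t\<bar> < e" for t
  proof -
    have "t \<in> {-e<..<e}"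
      using that by auto
    then have "\<gamma> t \<in> X"
      using \<gamma>(2) by blast
    then have "(norm (p - q))\<^sup>2 \<le> (norm (\<gamma> t - q))\<^sup>2"
      using nearest[of "\<gamma> t"] by (intro power_mono) (simp_all add: dist_commute flip: dist_norm)
    then show ?thesis
      by (simp add: \<phi>_def \<gamma>(3) power2_norm_eq_inner)
  qed
  ultimately have "2 * ((p - q) \<bullet> v) = 0"
    using \<gamma>(1) by (intro DERIV_local_min[of \<phi> _ 0 e]) auto
  then show ?thesis
    by (simp add: orthogonal_def inner_diff_left)
qed

section \<open>Normal rays and nearest points below the radius \<open>\<tau>\<close>\<close>

lemma condition_number_inverse_inj:
  assumes "has_condition_number_inverse X \<tau>" "r < \<tau>"
  shows "inj_on (\<lambda>(p, w). p + w) (open_normal_bundle X r)"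
proof -
  have "embedding_map (top_of_set (open_normal_bundle X r)) euclidean (\<lambda>(p, w). p + w)"
    using assms by (auto simp: has_condition_number_inverse_def smooth_embedding_def)
  then show ?thesis
    by (auto simp: embedding_map_def dest: homeomorphic_imp_injective_map)
qed

context
  fixes X :: "'a::euclidean_space set" and \<tau> :: real
  assumes X: "closed X" and \<tau>: "has_condition_number_inverse X \<tau>"
begin

text \<open>Both \<open>(p, q - p)\<close> and \<open>(p', q - p')\<close> are sent to
  \<open>q\<close> by the normal bundle map. A radius strictly between the distances and
  \<open>\<tau>\<close> is needed, as injectivity is known only below \<open>\<tau>\<close>.\<close>

lemma normal_decomposition_unique:
  assumes "p \<in> X" "\<And>v. v \<in> tangent_space X p \<Longrightarrow> orthogonal (q - p) v" "dist q p < \<tau>"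
    and "p' \<in> X" "\<And>v. v \<in> tangent_space X p' \<Longrightarrow> orthogonal (q - p') v" "dist q p' < \<tau>"
  shows "p = p'"
proof -
  obtain r where r: "dist q p < r" "dist q p' < r" "r < \<tau>"
    using dense[of "max (dist q p) (dist q p')" \<tau>] assms by auto
  then have "(p, q - p) \<in> open_normal_bundle X r" "(p', q - p') \<in> open_normal_bundle X r"
    using assms by (auto simp: open_normal_bundle_def dist_norm)
  from inj_onD[OF condition_number_inverse_inj[OF \<tau> r(3)] _ this] show ?thesis
    by simp
qed

lemma nearest_point_unique:
  assumes "p \<in> X" "\<And>x. x \<in> X \<Longrightarrow> dist q p \<le> dist q x" "dist q p < \<tau>"
    and "p' \<in> X" "\<And>x. x \<in> X \<Longrightarrow> dist q p' \<le> dist q x"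
  shows "p = p'"
proof (rule normal_decomposition_unique)
  show "dist q p' < \<tau>"
    using assms(3) assms(5)[OF assms(1)] by simp
qed (use assms in \<open>blast intro: nearest_point_normal\<close>)+

text \<open>The open ball of radius \<open>norm w\<close> about \<open>p + w\<close>, tangent to
  \<open>X\<close> at \<open>p\<close>, misses \<open>X\<close>. Below \<open>\<tau>\<close>, the
  nearest point to \<open>p + w\<close> gives a second normal decomposition and so equals
  \<open>p\<close>; the radius \<open>\<tau>\<close> itself is reached by shrinking
  \<open>w\<close>.\<close>

lemma normal_point_nearest:
  assumes p: "p \<in> X" and w: "\<And>v. v \<in> tangent_space X p \<Longrightarrow> orthogonal w v" "norm w \<le> \<tau>"
    and x: "x \<in> X"
  shows "norm w \<le> dist (p + w) x"
proof -
  have *: "norm w' \<le> dist (p + w') x"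
    if w': "\<And>v. v \<in> tangent_space X p \<Longrightarrow> orthogonal w' v" "norm w' < \<tau>" for w'
  proof -
    define p' where "p' = closest_point X (p + w')"
    have p': "p' \<in> X" "dist (p + w') p' \<le> dist (p + w') y" if "y \<in> X" for y
      using closest_point_exists[OF X, of "p + w'"] that by (auto simp: p'_def)
    have "p = p'"
    proof (rule normal_decomposition_unique)
      show "dist (p + w') p < \<tau>" "dist (p + w') p' < \<tau>"
        using w'(2) p'(2)[OF p] by (auto simp: dist_norm)
      show "orthogonal (p + w' - p') v" if "v \<in> tangent_space X p'" for v
        using nearest_point_normal[OF _ _ that] p' p by blast
    qed (use p p' w' in auto)
    then show ?thesis
      using p'(2)[OF x] by (simp add: dist_norm)
  qed
  show ?thesis
  proof (cases "w = 0")
    case False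
    show ?thesis
    proof (rule field_le_mult_one_interval)
      fix z :: real assume z: "0 < z" "z < 1"
      \<comment> \<open>Chosen so that \<open>t - (1 - t) = z\<close>: moving from
        \<open>t *\<^sub>R w\<close> to \<open>w\<close> costs \<open>(1 - t) * norm w\<close> in
        the triangle inequality.\<close>
      define t where "t = (z + 1) / 2"
      have t: "0 < t" "t < 1"
        using z by (auto simp: t_def)
      have "norm (t *\<^sub>R w) \<le> dist (p + t *\<^sub>R w) x"
      proof (rule *)
        show "orthogonal (t *\<^sub>R w) v" if "v \<in> tangent_space X p" for v
          using w(1)[OF that] by (simp add: orthogonal_def)
        have "t * norm w < 1 * norm w"
          using False t by (intro mult_strict_right_mono) auto
        then show "norm (t *\<^sub>R w) < \<tau>"
          using t w(2) by simp
      qed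
      also have "\<dots> \<le> dist (p + w) x + norm ((1 - t) *\<^sub>R w)"
        using norm_triangle_ineq4[of "p + w - x" "(1 - t) *\<^sub>R w"]
        by (simp add: dist_norm algebra_simps)
      finally have "t * norm w \<le> dist (p + w) x + (1 - t) * norm w"
        using t by simp
      moreover have "z * norm w = t * norm w - (1 - t) * norm w"
        by (simp add: t_def field_simps)
      ultimately show "z * norm w \<le> dist (p + w) x"
        by linarith
    qed
  qed simp
qed

text \<open>By uniqueness of nearest points, the closed inequalities that say \<open>p\<close> is
  nearest to \<open>q\<close> cut out exactly the graph; a closed graph into a compact space gives
  continuity.\<close>

lemma continuous_on_closest_point:
  assumes "bounded X" "\<And>q. q \<in> S \<Longrightarrow> \<exists>x\<in>X. dist q x < \<tau>"
  shows "continuous_on S (closest_point X)"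
proof (cases "S = {}")
  case False
  then have ne: "X \<noteq> {}"
    using assms(2) by blast
  have nearest: "closest_point X q \<in> X" "\<And>x. x \<in> X \<Longrightarrow> dist q (closest_point X q) \<le> dist q x" for q
    using closest_point_exists[OF X ne] by auto
  have "(\<lambda>q. (q, closest_point X q)) ` S =
      S \<times> X \<inter> (\<Inter>x\<in>X. {z. dist (fst z) (snd z) \<le> dist (fst z) x})" (is "_ = _ \<inter> ?C")
  proof (intro equalityI subsetI)
    fix z assume z: "z \<in> S \<times> X \<inter> ?C"
    obtain q p where qp: "z = (q, p)"
      by (cases z)
    obtain x where "x \<in> X" "dist q x < \<tau>"
      using assms(2) z qp by auto
    then have "dist q p < \<tau>"
      using z qp by fastforce
    then have "p = closest_point X q"
      using z qp nearest by (intro nearest_point_unique) auto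
    then show "z \<in> (\<lambda>q. (q, closest_point X q)) ` S"
      using z qp by auto
  qed (use nearest in auto)
  moreover have "closed ?C"
    by (intro closed_INT ballI closed_Collect_le continuous_intros)
  ultimately have "closedin (top_of_set (S \<times> X)) ((\<lambda>q. (q, closest_point X q)) ` S)"
    by (simp add: closedin_closed_Int)
  then show ?thesis
    using X assms(1) nearest(1) by (subst continuous_closed_graph_eq[of X]) (auto simp: compact_eq_bounded_closed)
qed simp

end

section \<open>Covering the segment to the nearest point\<close>

text \<open>Here \<open>r\<^sup>2 - 2 r b + m\<close> is the squared distance of a point \<open>l\<close> from the point at distance \<open>r\<close>
  on a normal ray: the ray meets the ball of radius \<open>\<delta>\<close> around \<open>l\<close> at \<open>t\<close> but not at \<open>t'\<close>, and the
  point at distance \<open>\<tau>\<close> is at least \<open>\<tau> - s\<close> away from \<open>l\<close>.\<close>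

lemma ray_ball_bound:
  fixes t t' b m s \<delta> \<tau> :: real
  assumes "t\<^sup>2 - 2 * t * b + m \<le> \<delta>\<^sup>2" "\<delta>\<^sup>2 < t'\<^sup>2 - 2 * t' * b + m"
    and far: "(\<tau> - s)\<^sup>2 \<le> \<tau>\<^sup>2 - 2 * \<tau> * b + m"
    and "t' \<le> t" "t < \<tau>" "0 < \<delta>" "\<delta> < \<tau> - s" and \<delta>: "\<delta>\<^sup>2 - (s + \<tau>) * \<delta> + 2 * s * \<tau> < 0"
  shows "t' \<le> \<delta> - s"
proof (rule ccontr)
  assume "\<not> t' \<le> \<delta> - s"
  have "t' < t"
    using assms by (cases "t' = t") auto
  \<comment> \<open>Subtracting the two ball conditions shows that the midpoint of \<open>t'\<close>
    and \<open>t\<close> lies before \<open>b\<close>, the parameter of the foot of the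
    perpendicular from \<open>l\<close>.\<close>
  have "(t - t') * (t + t' - 2 * b) < 0"
    using assms(1,2) by (simp add: algebra_simps power2_eq_square)
  then have tb: "t + t' < 2 * b"
    using \<open>t' < t\<close> by (simp add: mult_less_0_iff)
  show False
  proof (cases "b \<le> \<tau>")
    \<comment> \<open>By Pythagoras, the squared distance of \<open>l\<close> from the ray is at
      most \<open>\<delta>\<^sup>2\<close>, and the foot is less than
      \<open>\<tau> - \<delta> + s\<close> from the point at \<open>\<tau>\<close>. The lower bound
      \<open>\<tau> - s\<close> then contradicts the quadratic inequality for
      \<open>\<delta>\<close>.\<close>
    case True
    have "\<tau>\<^sup>2 - 2 * \<tau> * b + m = (\<tau> - b)\<^sup>2 - (t - b)\<^sup>2 + (t\<^sup>2 - 2 * t * b + m)"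
      by (simp add: algebra_simps power2_eq_square)
    also have "\<dots> \<le> (\<tau> - b)\<^sup>2 + \<delta>\<^sup>2"
      using assms(1) zero_le_power2[of "t - b"] by linarith
    also have "(\<tau> - b)\<^sup>2 \<le> (\<tau> - \<delta> + s)\<^sup>2"
      using True tb \<open>t' < t\<close> \<open>\<not> t' \<le> \<delta> - s\<close> by (intro power_mono) auto
    finally have "(\<tau> - s)\<^sup>2 \<le> (\<tau> - \<delta> + s)\<^sup>2 + \<delta>\<^sup>2"
      using far by linarith
    then have "0 \<le> 2 * (\<delta>\<^sup>2 - (s + \<tau>) * \<delta> + 2 * s * \<tau>)"
      by (simp add: algebra_simps power2_eq_square)
    moreover have "2 * (\<delta>\<^sup>2 - (s + \<tau>) * \<delta> + 2 * s * \<tau>) < 0"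
      using \<delta> by (intro mult_pos_neg) auto
    ultimately show False
      by (meson not_le)
  next
    \<comment> \<open>Up to the foot the distance to \<open>l\<close> decreases, so the point at
      \<open>\<tau>\<close> is within \<open>\<delta>\<close> of \<open>l\<close>, against
      \<open>\<delta> < \<tau> - s\<close>.\<close>
    case False
    have "(\<tau> - t) * (\<tau> + t - 2 * b) < 0"
      using False \<open>t < \<tau>\<close> by (intro mult_pos_neg) auto
    then have "\<tau>\<^sup>2 - 2 * \<tau> * b + m \<le> t\<^sup>2 - 2 * t * b + m"
      by (simp add: algebra_simps power2_eq_square)
    then have "(\<tau> - s)\<^sup>2 \<le> \<delta>\<^sup>2"
      using far assms(1) by linarith
    then show False
      using assms power_strict_mono[of \<delta> "\<tau> - s" 2] by simp
  qed
qed

text \<open>The ends of the interval are the roots of the quadratic, whose discriminant is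
  \<open>(s + \<tau>)\<^sup>2 - 8 * s * \<tau>\<close>.\<close>

lemma radius_bounds:
  fixes s \<tau> \<delta> :: real
  assumes s: "0 < s" "s < (sqrt 9 - sqrt 8) * \<tau>"
    and \<delta>: "\<delta> \<in> {((s + \<tau>) - sqrt (s\<^sup>2 + \<tau>\<^sup>2 - 6 * s * \<tau>)) / 2 <..<
              ((s + \<tau>) + sqrt (s\<^sup>2 + \<tau>\<^sup>2 - 6 * s * \<tau>)) / 2}"
  shows "\<delta>\<^sup>2 - (s + \<tau>) * \<delta> + 2 * s * \<tau> < 0" "s < \<delta>" "\<delta> + s < \<tau>"
proof -
  let ?R = "s\<^sup>2 + \<tau>\<^sup>2 - 6 * s * \<tau>"
  have "\<bar>2 * \<delta> - (s + \<tau>)\<bar> < sqrt ?R"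
    using \<delta> by (auto simp: abs_less_iff)
  then have "(2 * \<delta> - (s + \<tau>))\<^sup>2 < (sqrt ?R)\<^sup>2" "0 < ?R"
    by (metis abs_ge_zero power2_abs power_strict_mono zero_less_numeral,
        metis abs_ge_zero le_less_trans real_sqrt_gt_0_iff)
  then have "(2 * \<delta> - (s + \<tau>))\<^sup>2 < ?R"
    by simp
  then show quad: "\<delta>\<^sup>2 - (s + \<tau>) * \<delta> + 2 * s * \<tau> < 0"
    by (simp add: algebra_simps power2_eq_square)
  \<comment> \<open>The bound \<open>8 / 3\<close> gives \<open>sqrt 9 - sqrt 8 \<le> 1 / 3\<close>,
    hence \<open>3 * s < \<tau>\<close>.\<close>
  have c: "8 / 3 \<le> sqrt 8" "sqrt 8 < 3" "sqrt 9 = 3"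
    by (rule real_le_rsqrt real_less_lsqrt real_sqrt_unique; simp add: power2_eq_square)+
  have \<tau>: "0 < \<tau>"
  proof (rule ccontr)
    assume "\<not> 0 < \<tau>"
    then have "(sqrt 9 - sqrt 8) * \<tau> \<le> 0"
      using c by (intro mult_nonneg_nonpos) auto
    then show False
      using s by linarith
  qed
  have "(sqrt 9 - sqrt 8) * \<tau> \<le> 1 / 3 * \<tau>"
    using c \<tau> by (intro mult_right_mono) auto
  then have s3: "3 * s < \<tau>"
    using s(2) by linarith
  show "s < \<delta>"
  proof (rule ccontr)
    assume "\<not> s < \<delta>"
    then have "0 \<le> (s - \<delta>) * (\<tau> - \<delta>)" "0 < s * \<tau>"
      using s3 s(1) by auto
    \<comment> \<open>With this regrouping, \<open>\<delta> \<le> s\<close> makes the quadratic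
      positive.\<close>
    moreover have "\<delta>\<^sup>2 - (s + \<tau>) * \<delta> + 2 * s * \<tau> = (s - \<delta>) * (\<tau> - \<delta>) + s * \<tau>"
      by (simp add: algebra_simps power2_eq_square)
    ultimately show False
      using quad by linarith
  qed
  show "\<delta> + s < \<tau>"
  proof (rule ccontr)
    assume "\<not> \<delta> + s < \<tau>"
    \<comment> \<open>Here \<open>\<delta> \<ge> \<tau> - s > 2 * s\<close>, so both factors are
      nonnegative.\<close>
    then have "0 \<le> (\<delta> - \<tau> + s) * (\<delta> - 2 * s)" "0 < 2 * s\<^sup>2"
      using s3 s(1) by auto
    moreover have "\<delta>\<^sup>2 - (s + \<tau>) * \<delta> + 2 * s * \<tau> = (\<delta> - \<tau> + s) * (\<delta> - 2 * s) + 2 * s\<^sup>2"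
      by (simp add: algebra_simps power2_eq_square)
    ultimately show False
      using quad by linarith
  qed
qed

text \<open>A point of the segment that has left the ball about \<open>l\<close> is within
  \<open>\<delta> - s\<close> of \<open>p\<close>, hence in the ball about \<open>l'\<close>, whose
  center is less than \<open>s\<close> away from \<open>p\<close>.\<close>

lemma segment_to_nearest_point_covered:
  fixes X :: "'a::euclidean_space set"
  assumes X: "closed X" and \<tau>: "has_condition_number_inverse X \<tau>"
    and \<delta>: "\<delta>\<^sup>2 - (s + \<tau>) * \<delta> + 2 * s * \<tau> < 0" "s < \<delta>" "\<delta> + s < \<tau>" "0 < s"
    and l: "x \<in> X" "dist x l < s" "dist l q \<le> \<delta>" and l': "dist p l' < s"
    and p: "p \<in> X" "\<And>y. y \<in> X \<Longrightarrow> dist q p \<le> dist q y"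
    and c: "0 \<le> c" "c \<le> 1"
  shows "p + c *\<^sub>R (q - p) \<in> cball l \<delta> \<union> cball l' \<delta>"
proof (cases "q = p")
  case True
  then show ?thesis
    using l' \<delta> by (simp add: dist_commute)
next
  case False
  define t where "t = dist q p"
  define n where "n = (q - p) /\<^sub>R t"
  have t: "0 < t" "q = p + t *\<^sub>R n" "norm n = 1"
    using False by (auto simp: t_def n_def dist_norm)
  have t\<tau>: "t < \<tau>"
  proof -
    have "t \<le> dist q x"
      using p(2)[OF l(1)] by (simp add: t_def)
    also have "\<dots> \<le> dist l q + dist x l"
      by (metis dist_commute dist_triangle add.commute)
    finally show ?thesis
      using l \<delta> by linarith
  qed
  have normal: "orthogonal (\<tau> *\<^sub>R n) v" if "v \<in> tangent_space X p" for v
    using nearest_point_normal[OF p that] by (simp add: n_def orthogonal_def)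
  \<comment> \<open>The ball of full radius \<open>\<tau>\<close> tangent at \<open>p\<close> misses
    \<open>X\<close>; as \<open>x\<close> is within \<open>s\<close> of \<open>l\<close>, its center
    is at least \<open>\<tau> - s\<close> away from \<open>l\<close>.\<close>
  have "norm (\<tau> *\<^sub>R n) \<le> dist (p + \<tau> *\<^sub>R n) x"
    using normal_point_nearest[OF X \<tau> p(1) normal _ l(1)] t t\<tau> by simp
  then have "\<tau> \<le> dist (p + \<tau> *\<^sub>R n) x"
    using t t\<tau> by simp
  also have "\<dots> \<le> dist (p + \<tau> *\<^sub>R n) l + dist x l"
    using dist_triangle2[of "p + \<tau> *\<^sub>R n" x l] by (simp add: dist_commute)
  finally have far: "\<tau> - s \<le> dist (p + \<tau> *\<^sub>R n) l"
    using l(2) by linarith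
  \<comment> \<open>This is the form used in \<open>ray_ball_bound\<close>, with
    \<open>b = (l - p) \<bullet> n\<close> and \<open>m = (l - p) \<bullet> (l - p)\<close>.\<close>
  have sq: "(dist (p + r *\<^sub>R n) l)\<^sup>2 = r\<^sup>2 - 2 * r * ((l - p) \<bullet> n) + (l - p) \<bullet> (l - p)" for r
  proof -
    have "(r *\<^sub>R n - a) \<bullet> (r *\<^sub>R n - a) = r\<^sup>2 * (n \<bullet> n) - 2 * r * (a \<bullet> n) + a \<bullet> a" for a
      by (simp add: inner_diff_left inner_diff_right inner_commute power2_eq_square algebra_simps)
    moreover have "dist (p + r *\<^sub>R n) l = norm (r *\<^sub>R n - (l - p))"
      by (simp add: dist_norm algebra_simps)
    ultimately show ?thesis
      using t(3) by (simp add: power2_norm_eq_inner norm_eq_1)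
  qed
  define t' where "t' = c * t"
  have y: "p + c *\<^sub>R (q - p) = p + t' *\<^sub>R n"
    using t by (simp add: t'_def)
  have t': "0 \<le> t'" "t' \<le> t"
    using c t by (auto simp: t'_def mult_left_le_one_le)
  show ?thesis
  proof (cases "p + t' *\<^sub>R n \<in> cball l \<delta>")
    case False
    have "t' \<le> \<delta> - s"
    proof (rule ray_ball_bound)
      show "t\<^sup>2 - 2 * t * ((l - p) \<bullet> n) + (l - p) \<bullet> (l - p) \<le> \<delta>\<^sup>2"
        unfolding sq[symmetric] using l(3) t(2) by (intro power_mono) (auto simp: dist_commute)
      show "\<delta>\<^sup>2 < t'\<^sup>2 - 2 * t' * ((l - p) \<bullet> n) + (l - p) \<bullet> (l - p)"
        unfolding sq[symmetric] using False \<delta> by (intro power_strict_mono) (auto simp: dist_commute)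
      show "(\<tau> - s)\<^sup>2 \<le> \<tau>\<^sup>2 - 2 * \<tau> * ((l - p) \<bullet> n) + (l - p) \<bullet> (l - p)"
        unfolding sq[symmetric] using far \<delta> by (intro power_mono) auto
    qed (use \<delta> t\<tau> t' in auto)
    moreover have "dist (p + t' *\<^sub>R n) l' \<le> t' + dist p l'"
      using norm_triangle_ineq[of "t' *\<^sub>R n" "p - l'"] t t'(1)
      by (simp add: dist_norm algebra_simps)
    ultimately show ?thesis
      unfolding y using l' by (simp add: dist_commute)
  qed (simp add: y)
qed


section \<open>Modulus of continuity and the domain of the Betti numbers\<close>

lemma le_modulus_of_continuity:
  assumes "norm (p - p') \<le> \<epsilon>"
  shows "ereal \<bar>f p $ j - f p' $ j\<bar> \<le> modulus_of_continuity f \<epsilon>"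
proof -
  have "ereal \<bar>f p $ j - f p' $ j\<bar> \<le>
      (SUP (p, p') \<in> {(p, p'). norm (p - p') \<le> \<epsilon>}. ereal \<bar>f p $ j - f p' $ j\<bar>)"
    using assms by (intro SUP_upper2[of "(p, p')"]) auto
  also have "\<dots> \<le> modulus_of_continuity f \<epsilon>"
    unfolding modulus_of_continuity_def by (intro Max_ge) auto
  finally show ?thesis .
qed

text \<open>Supplies the connectedness of closed max-norm balls.\<close>

lemma convex_infnorm_ball: "convex {q :: 'a::euclidean_space. infnorm (a - q) \<le> r}"
proof (rule convexI)
  fix x y :: 'a and \<mu> \<nu> :: real
  assume x: "x \<in> {q. infnorm (a - q) \<le> r}" and y: "y \<in> {q. infnorm (a - q) \<le> r}"
    and \<mu>: "0 \<le> \<mu>" "0 \<le> \<nu>" "\<mu> + \<nu> = 1"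
  have "a - (\<mu> *\<^sub>R x + \<nu> *\<^sub>R y) = \<mu> *\<^sub>R (a - x) + \<nu> *\<^sub>R (a - y)"
    using \<mu>(3) by (simp add: algebra_simps flip: scaleR_add_left)
  then have "infnorm (a - (\<mu> *\<^sub>R x + \<nu> *\<^sub>R y)) \<le> \<mu> * infnorm (a - x) + \<nu> * infnorm (a - y)"
    using infnorm_triangle[of "\<mu> *\<^sub>R (a - x)" "\<nu> *\<^sub>R (a - y)"] \<mu> by (simp add: infnorm_mul)
  also have "\<dots> \<le> r"
    using x y \<mu> by (intro convex_bound_le) auto
  finally show "\<mu> *\<^sub>R x + \<nu> *\<^sub>R y \<in> {q. infnorm (a - q) \<le> r}"
    by simp
qed

text \<open>The basis of the product consists of those of the two factors, so \<open>infnorm\<close>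
  is the max norm over all coordinates of the pair.\<close>

lemma infnorm_pair_le:
  fixes x y :: "real ^ 'n"
  assumes "\<And>j. \<bar>x $ j\<bar> \<le> r" "\<And>j. \<bar>y $ j\<bar> \<le> r"
  shows "infnorm (x, y) \<le> r"
  unfolding infnorm_Max using assms
  by (subst Max_le_iff) (auto simp: Basis_prod_def Basis_vec_def inner_axis)

lemma not_in_Delta_plus: "(u, u) \<notin> Delta_plus"
  by (auto simp: Delta_plus_def strictly_below_def)

text \<open>Continuity into a discrete space is local constancy, which passes from
  \<open>Delta_plus\<close> to the subset \<open>S\<close>; connectedness makes it global.\<close>

lemma locally_constant_on_Delta_plus:
  assumes "connected S" "S \<subseteq> Delta_plus" "\<And>q. q \<in> S \<Longrightarrow> \<not> discontinuity_point \<beta> q"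
    and "a \<in> S" "b \<in> S"
  shows "\<beta> a = \<beta> b"
proof (rule connected_local_const[OF assms(1,4,5)], intro ballI)
  fix q assume q: "q \<in> S"
  then have "limitin (discrete_topology UNIV) \<beta> (\<beta> q) (at q within Delta_plus)"
    using assms(2) assms(3)[OF q] unfolding discontinuity_point_def by blast
  then have "\<forall>\<^sub>F z in at q within Delta_plus. \<beta> z \<in> {\<beta> q}"
    unfolding limitin_def by (metis UNIV_I insertI1 openin_discrete_topology subset_UNIV)
  then have "\<forall>\<^sub>F z in at q within S. \<beta> z \<in> {\<beta> q}"
    using at_le[OF assms(2), of q] by (rule filter_leD[rotated])
  then show "\<forall>\<^sub>F z in at q within S. \<beta> q = \<beta> z"
    by (rule eventually_mono) auto
qed

section \<open>Comparison of the Betti numbers of \<open>X\<close> and of the union of balls\<close>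

theorem mainTheorem2:
  fixes X :: "(real ^ 'm) set"
    and d :: nat
    and \<tau> s \<delta> :: real
    and f :: "real ^ 'm \<Rightarrow> real ^ 'n"
    and L :: "(real ^ 'm) set"
    and i :: int
  defines "U \<equiv> (\<Union>l\<in>L. cball l \<delta>)"
    and "\<Omega> \<equiv> modulus_of_continuity f"
  defines "\<beta>\<^sub>X \<equiv> persistent_betti TYPE('k::field) X f i"
    and "\<beta>\<^sub>U \<equiv> persistent_betti TYPE('k) U f i"
  assumes "compact X"
    and "smooth_submanifold X d"
    and "triangulable_submanifold X"
    and "has_condition_number_inverse X \<tau>"
    and "continuous_on UNIV f"
    and "0 < s" and "s < (sqrt 9 - sqrt 8) * \<tau>"
    and "\<delta> \<in> {((s + \<tau>) - sqrt (s\<^sup>2 + \<tau>\<^sup>2 - 6 * s * \<tau>)) / 2 <..<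
              ((s + \<tau>) + sqrt (s\<^sup>2 + \<tau>\<^sup>2 - 6 * s * \<tau>)) / 2}"
    and "finite L"
    and "L \<subseteq> tubular_neighborhood X s"
    and "\<forall>p\<in>X. \<exists>l\<in>L. norm (p - l) < s"
  shows "(\<forall>\<omega> u v. (\<forall>j. ereal (\<omega> $ j) = \<Omega> (\<delta> + s)) \<and> (u, v) \<in> Delta_plus \<and> u + \<omega> \<prec> v - \<omega> \<longrightarrow>
            \<beta>\<^sub>U (u - \<omega>, v + \<omega>) \<le> \<beta>\<^sub>X (u, v) \<and> \<beta>\<^sub>X (u, v) \<le> \<beta>\<^sub>U (u + \<omega>, v - \<omega>))
       \<and> (\<forall>u v. (u, v) \<in> Delta_plus \<and> \<beta>\<^sub>X (u, v) \<noteq> \<beta>\<^sub>U (u, v) \<longrightarrow>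
            (\<exists>u' v'. ereal (infnorm ((u, v) - (u', v'))) \<le> \<Omega> (\<delta> + s) \<and>
               ((u', v') \<in> frontier Delta_plus \<or> discontinuity_point \<beta>\<^sub>U (u', v'))))"
proof -
  note \<delta>_range = assms(12) and L = assms(13-15)
  note bounds = radius_bounds[OF \<open>0 < s\<close> \<open>s < (sqrt 9 - sqrt 8) * \<tau>\<close> \<delta>_range]
  have "closed X"
    using \<open>compact X\<close> by (rule compact_imp_closed)
  note near = this \<open>has_condition_number_inverse X \<tau>\<close>
  define \<rho> where "\<rho> = closest_point X"
  have \<rho>: "\<rho> q \<in> X" "\<And>x. x \<in> X \<Longrightarrow> dist q (\<rho> q) \<le> dist q x" if "X \<noteq> {}" for q
    using closest_point_exists[OF near(1) that] by (auto simp: \<rho>_def)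
  have near_L: "\<exists>x\<in>X. dist x l < s" if "l \<in> L" for l
  proof -
    have "l \<in> tubular_neighborhood X s"
      using that L(2) by blast
    then obtain x w where "x \<in> X" "norm w < s" "l = x + w"
      by (auto simp: tubular_neighborhood_def open_normal_bundle_def)
    then show ?thesis
      by (intro bexI[of _ x]) (simp_all add: dist_norm)
  qed
  have near_U: "\<exists>x\<in>X. dist q x < \<delta> + s" if q: "q \<in> U" for q
  proof -
    obtain l where l: "l \<in> L" "dist l q \<le> \<delta>"
      using q by (auto simp: U_def)
    obtain x where "x \<in> X" "dist x l < s"
      using near_L[OF l(1)] by blast
    then show ?thesis
      using l(2) dist_triangle[of q x l] by (auto simp: dist_commute intro!: bexI[of _ x])
  qed
  have \<rho>_dist: "\<rho> q \<in> X" "dist q (\<rho> q) \<le> \<delta> + s" if q: "q \<in> U" for q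
  proof -
    obtain x where x: "x \<in> X" "dist q x < \<delta> + s"
      using near_U[OF q] by blast
    then have "X \<noteq> {}"
      by blast
    note \<rho> = \<rho>[OF this]
    show "\<rho> q \<in> X"
      by (rule \<rho>(1))
    show "dist q (\<rho> q) \<le> \<delta> + s"
      using \<rho>(2)[OF x(1), of q] x(2) by linarith
  qed
  have "compact U"
    unfolding U_def using L(1) by (intro compact_UN) auto
  have "X \<subseteq> U"
  proof
    fix p assume "p \<in> X"
    then obtain l where "l \<in> L" "norm (p - l) < s"
      using L(3) by blast
    then show "p \<in> U"
      using bounds(2) by (auto simp: U_def dist_norm norm_minus_commute intro!: bexI[of _ l])
  qed
  have "continuous_on U \<rho>"
    unfolding \<rho>_def
  proof (rule continuous_on_closest_point[OF near])
    show "\<exists>x\<in>X. dist q x < \<tau>" if "q \<in> U" for q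
      using near_U[OF that] bounds(3) by force
  qed (use \<open>compact X\<close> compact_imp_bounded in auto)
  have \<rho>_id: "\<rho> p = p" if "p \<in> X" for p
    using that by (simp add: \<rho>_def closest_point_self)
  have segment: "(1 - t) *\<^sub>R q + t *\<^sub>R \<rho> q \<in> U" if q: "q \<in> U" and t: "0 \<le> t" "t \<le> 1" for q t
  proof -
    obtain l where l: "l \<in> L" "dist l q \<le> \<delta>"
      using q by (auto simp: U_def)
    obtain x where x: "x \<in> X" "dist x l < s"
      using near_L[OF l(1)] by blast
    have \<rho>q: "\<rho> q \<in> X" "\<And>y. y \<in> X \<Longrightarrow> dist q (\<rho> q) \<le> dist q y"
      using \<rho> x(1) by blast+
    obtain l' where l': "l' \<in> L" "dist (\<rho> q) l' < s"
      using L(3) \<rho>q(1) by (auto simp: dist_norm)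
    \<comment> \<open>The segment is parametrized from its end \<open>\<rho> q\<close>, so
      \<open>t\<close> becomes \<open>1 - t\<close>; \<open>l\<close> accounts for \<open>q\<close>
      and \<open>l'\<close> for \<open>\<rho> q\<close>.\<close>
    have "\<rho> q + (1 - t) *\<^sub>R (q - \<rho> q) \<in> cball l \<delta> \<union> cball l' \<delta>"
      using t by (intro segment_to_nearest_point_covered[OF near bounds \<open>0 < s\<close> x l(2) l'(2) \<rho>q]) auto
    moreover have "\<rho> q + (1 - t) *\<^sub>R (q - \<rho> q) = (1 - t) *\<^sub>R q + t *\<^sub>R \<rho> q"
      by (simp add: algebra_simps)
    ultimately show ?thesis
      using l l' by (auto simp: U_def)
  qed
  have variation: "ereal \<bar>f q $ j - f ((1 - t) *\<^sub>R q + t *\<^sub>R \<rho> q) $ j\<bar> \<le> \<Omega> (\<delta> + s)"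
    if q: "q \<in> U" and t: "0 \<le> t" "t \<le> 1" for q t j
  proof -
    have "q - ((1 - t) *\<^sub>R q + t *\<^sub>R \<rho> q) = t *\<^sub>R (q - \<rho> q)"
      by (simp add: algebra_simps)
    then have "norm (q - ((1 - t) *\<^sub>R q + t *\<^sub>R \<rho> q)) = t * dist q (\<rho> q)"
      using t by (simp add: dist_norm)
    also have "\<dots> \<le> \<delta> + s"
      using \<rho>_dist(2)[OF q] t mult_left_le_one_le[of "dist q (\<rho> q)" t] by force
    finally show ?thesis
      unfolding \<Omega>_def by (rule le_modulus_of_continuity)
  qed
  \<comment> \<open>Such an \<open>\<omega>\<close> exists only if
    \<open>\<Omega> (\<delta> + s)\<close> is finite; the infinite case reappears in the second
    part.\<close>
  have part1: "\<beta>\<^sub>U (u - \<omega>, v + \<omega>) \<le> \<beta>\<^sub>X (u, v)" "\<beta>\<^sub>X (u, v) \<le> \<beta>\<^sub>U (u + \<omega>, v - \<omega>)"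
    if \<omega>: "\<forall>j. ereal (\<omega> $ j) = \<Omega> (\<delta> + s)" and uv: "(u, v) \<in> Delta_plus"
      and uv': "(u + \<omega>, v - \<omega>) \<in> Delta_plus" for \<omega> u v
  proof -
    have variation': "\<bar>f q $ j - f ((1 - t) *\<^sub>R q + t *\<^sub>R \<rho> q) $ j\<bar> \<le> \<omega> $ j"
      if "q \<in> U" "0 \<le> t" "t \<le> 1" for q t j
      using variation[OF that, of j] \<omega>[rule_format, of j, symmetric] by simp
    have "continuous_on U f"
      using \<open>continuous_on UNIV f\<close> by (rule continuous_on_subset) simp
    note retract = persistent_betti_retract[OF \<open>compact X\<close> \<open>compact U\<close> \<open>X \<subseteq> U\<close> this
        \<open>continuous_on U \<rho>\<close> _ \<rho>_id segment variation']
    show "\<beta>\<^sub>U (u - \<omega>, v + \<omega>) \<le> \<beta>\<^sub>X (u, v)"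
      unfolding \<beta>\<^sub>X_def \<beta>\<^sub>U_def using uv \<rho>_dist(1)
      by (intro retract(1)) (auto simp: Delta_plus_def strictly_below_def less_imp_le)
    show "\<beta>\<^sub>X (u, v) \<le> \<beta>\<^sub>U (u + \<omega>, v - \<omega>)"
      unfolding \<beta>\<^sub>X_def \<beta>\<^sub>U_def using uv' \<rho>_dist(1)
      by (intro retract(2)) (auto simp: Delta_plus_def strictly_below_def less_imp_le)
  qed
  have part2: "\<exists>u' v'. ereal (infnorm ((u, v) - (u', v'))) \<le> \<Omega> (\<delta> + s) \<and>
      ((u', v') \<in> frontier Delta_plus \<or> discontinuity_point \<beta>\<^sub>U (u', v'))"
    if uv: "(u, v) \<in> Delta_plus" and ne: "\<beta>\<^sub>X (u, v) \<noteq> \<beta>\<^sub>U (u, v)" for u v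
  proof (rule ccontr)
    \<comment> \<open>The closed max-norm ball about \<open>(u, v)\<close>, or the whole space if
      the modulus is infinite; connected in either case.\<close>
    define S where "S = {q. ereal (infnorm ((u, v) - q)) \<le> \<Omega> (\<delta> + s)}"
    assume "\<nexists>u' v'. ereal (infnorm ((u, v) - (u', v'))) \<le> \<Omega> (\<delta> + s) \<and>
      ((u', v') \<in> frontier Delta_plus \<or> discontinuity_point \<beta>\<^sub>U (u', v'))"
    then have none: "S \<inter> frontier Delta_plus = {}" "\<And>q. q \<in> S \<Longrightarrow> \<not> discontinuity_point \<beta>\<^sub>U q"
      by (auto simp: S_def)
    have \<Omega>0: "0 \<le> \<Omega> (\<delta> + s)"
      using le_modulus_of_continuity[of 0 0 "\<delta> + s" f] bounds(2) \<open>0 < s\<close> by (simp add: \<Omega>_def zero_ereal_def)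
    have "connected S"
    proof (cases "\<Omega> (\<delta> + s)")
      case (real r)
      then show ?thesis
        by (simp add: S_def convex_connected convex_infnorm_ball)
    qed (use \<Omega>0 in \<open>auto simp: S_def\<close>)
    moreover have "(u, v) \<in> S"
      using \<Omega>0 by (simp add: S_def infnorm_0 zero_ereal_def[symmetric] flip: zero_prod_def)
    \<comment> \<open>A connected set that meets \<open>Delta_plus\<close> and avoids its frontier
      lies inside it.\<close>
    ultimately have S: "S \<subseteq> Delta_plus"
      using connected_Int_frontier[of S Delta_plus] none(1) uv by blast
    show False
    proof (cases "\<Omega> (\<delta> + s)")
      case (real r)
      define \<omega> :: "real ^ 'n" where "\<omega> = (\<chi> j. r)"
      have \<omega>: "\<forall>j. ereal (\<omega> $ j) = \<Omega> (\<delta> + s)" and "0 \<le> r"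
        using real \<Omega>0 by (simp_all add: \<omega>_def)
      then have box: "(u - \<omega>, v + \<omega>) \<in> S" "(u + \<omega>, v - \<omega>) \<in> S"
        by (auto simp: S_def real \<omega>_def intro!: infnorm_pair_le)
      \<comment> \<open>Both shifted points are in the ball, so \<open>\<beta>\<^sub>U\<close> takes
        the value at \<open>(u, v)\<close> there and the inequalities of the first part pinch
        \<open>\<beta>\<^sub>X (u, v)\<close>.\<close>
      have "\<beta>\<^sub>U (u - \<omega>, v + \<omega>) = \<beta>\<^sub>U (u, v)" "\<beta>\<^sub>U (u + \<omega>, v - \<omega>) = \<beta>\<^sub>U (u, v)"
        using locally_constant_on_Delta_plus[OF \<open>connected S\<close> S none(2)] box \<open>(u, v) \<in> S\<close> by blast+
      then have "\<beta>\<^sub>X (u, v) = \<beta>\<^sub>U (u, v)"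
        using part1[OF \<omega> uv] box S by (metis order_antisym subsetD)
      then show False
        using ne by simp
    next
      \<comment> \<open>Now \<open>S\<close> is everything and contains diagonal points, which are
        not in \<open>Delta_plus\<close>.\<close>
      case PInf
      then have "(u, u) \<in> S"
        by (simp add: S_def)
      then show False
        using S not_in_Delta_plus by blast
    qed (use \<Omega>0 in auto)
  qed
  show ?thesis
    using part1 part2 by (auto simp: Delta_plus_def)
qed

end
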